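(* Let $\Lambda\in\{\mathbf{Int},\mathbf{KC}\}$ and $m,n\in\{1,2,\omega\}$. Then the normal modal logic $\Gamma(\Lambda,m,n)=\tau(\Lambda)\oplus\gamma_m\oplus\bar\gamma_n$ has the Craig interpolation property.
   Context: Modal formulas are built from (countably many) atomic propositions using the constants $\bot,\top$, unary connectives $\lnot,\Box$ and binary connectives $\land,\lor$; $\to,\leftrightarrow,\Diamond$ are defined as usual. For a normal modal logic $L$ and formulas (or sets of formulas) $\alpha$, $L\oplus\alpha$ is the smallest normal modal logic containing $L$ and $\alpha$. $\mathbf{S4}$ is the normal modal logic of preorders (reflexive transitive frames), and $\mathbf{S4.2}=\mathbf{S4}\oplus\Diamond\Box p\to\Box\Diamond p$. $\mathbf{Int}$ is intuitionistic propositional logic and $\mathbf{KC}=\mathbf{Int}+(\lnot p\lor\lnot\lnot p)$. For a superintuitionistic logic $\Lambda$, $\tau(\Lambda)$ denotes its smallest modal companion (among normal extensions of $\mathbf{S4}$); in particular $\tau(\mathbf{Int})=\mathbf{S4}$ and $\tau(\mathbf{KC})=\mathbf{S4.2}$. For $k\in\mathbb N$ write $[k]=\{0,\dots,k-1\}$. Frame formulas: for a finite rooted preorder $\mathfrak F=\langle[k],\preceq\rangle$ with root $0$, the formula $\chi(\mathfrak F)$ in the atomic propositions $p_0,\dots,p_{k-1}$ is the negation of the conjunction of: (i) $p_0$; (ii) $\Box(p_0\lor\dots\lor p_{k-1})$; (iii) $\Box(p_i\to\lnot p_j)$ for all $i\ne j$; (iv) $\Box(p_i\to\Diamond p_j)$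 for all $i\preceq j$; (v) $\Box(p_i\to\lnot\Diamond p_j)$ for all $i\not\preceq j$. For $k\ge 1$ let $\mathfrak C_k=\langle[k],\preceq\rangle$ with $i\preceq j$ for all $i,j\in[k]$ (a cluster of size $k$), and let $\overline{\mathfrak C}_k=\langle[k+1],\preceq\rangle$ with $i\preceq j$ iff $i\in[k]$ or $i=j=k$ (a cluster of size $k$ with a single reflexive point $k$ strictly above it). For $n\in\mathbb N$ put $\gamma_n=\chi(\mathfrak C_{n+1})$ and $\bar\gamma_n=\chi(\overline{\mathfrak C}_{n+1})$; also $\gamma_\omega=\bar\gamma_\omega=\top$. A logic $L$ has the Craig interpolation property if for all formulas $\varphi,\psi$ with $\varphi\to\psi\in L$ there is a formula $\chi$, all of whose atomic propositions occur in both $\varphi$ and $\psi$, such that $\varphi\to\chi\in L$ and $\chi\to\psi\in L$. *)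

theory Defs
  imports "HOL-Library.Countable" "HOL-Library.Extended_Nat"
begin

section \<open>Modal formulas\<close>

datatype form =
    Atom nat
  | Bot
  | Top
  | Neg form
  | Box form
  | And form form
  | Or form form

instance form :: countable
  by countable_datatype

abbreviation Imp :: "form \<Rightarrow> form \<Rightarrow> form" where
  "Imp \<phi> \<psi> \<equiv> Or (Neg \<phi>) \<psi>"

abbreviation Dia :: "form \<Rightarrow> form" where
  "Dia \<phi> \<equiv> Neg (Box (Neg \<phi>))"

primrec atoms :: "form \<Rightarrow> nat set" where
  "atoms (Atom p) = {p}"
| "atoms Bot = {}"
| "atoms Top = {}"
| "atoms (Neg \<phi>) = atoms \<phi>"
| "atoms (Box \<phi>) = atoms \<phi>"
| "atoms (And \<phi> \<psi>) = atoms \<phi> \<union> atoms \<psi>"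
| "atoms (Or \<phi> \<psi>) = atoms \<phi> \<union> atoms \<psi>"

primrec subst :: "(nat \<Rightarrow> form) \<Rightarrow> form \<Rightarrow> form" where
  "subst s (Atom p) = s p"
| "subst s Bot = Bot"
| "subst s Top = Top"
| "subst s (Neg \<phi>) = Neg (subst s \<phi>)"
| "subst s (Box \<phi>) = Box (subst s \<phi>)"
| "subst s (And \<phi> \<psi>) = And (subst s \<phi>) (subst s \<psi>)"
| "subst s (Or \<phi> \<psi>) = Or (subst s \<phi>) (subst s \<psi>)"


section \<open>Normal modal logics\<close>

text \<open>Classical truth value; formulas \<open>Box \<phi>\<close> are treated like atoms.\<close>

primrec tval :: "(form \<Rightarrow> bool) \<Rightarrow> form \<Rightarrow> bool" where
  "tval v (Atom p) = v (Atom p)"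
| "tval v Bot = False"
| "tval v Top = True"
| "tval v (Neg \<phi>) = (\<not> tval v \<phi>)"
| "tval v (Box \<phi>) = v (Box \<phi>)"
| "tval v (And \<phi> \<psi>) = (tval v \<phi> \<and> tval v \<psi>)"
| "tval v (Or \<phi> \<psi>) = (tval v \<phi> \<or> tval v \<psi>)"

definition tautology :: "form \<Rightarrow> bool" where
  "tautology \<phi> \<longleftrightarrow> (\<forall>v. tval v \<phi>)"

definition normal_logic :: "form set \<Rightarrow> bool" where
  "normal_logic L \<longleftrightarrow>
     (\<forall>\<phi>. tautology \<phi> \<longrightarrow> \<phi> \<in> L) \<and>
     (\<forall>\<phi> \<psi>. Imp (Box (Imp \<phi> \<psi>)) (Imp (Box \<phi>) (Box \<psi>)) \<in> L) \<and>
     (\<forall>\<phi> \<psi>. \<phi> \<in> L \<longrightarrow> Imp \<phi> \<psi> \<in> L \<longrightarrow> \<psi> \<in> L) \<and>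
     (\<forall>\<phi>. \<phi> \<in> L \<longrightarrow> Box \<phi> \<in> L) \<and>
     (\<forall>\<phi> s. \<phi> \<in> L \<longrightarrow> subst s \<phi> \<in> L)"

definition normal_ext :: "form set \<Rightarrow> form set \<Rightarrow> form set" (infixl "\<oplus>" 65) where
  "L \<oplus> A = \<Inter>{L'. normal_logic L' \<and> L \<subseteq> L' \<and> A \<subseteq> L'}"

lemma normal_ext_normal: "normal_logic (L \<oplus> A)"
  unfolding normal_ext_def normal_logic_def by blast

lemma normal_ext_minimal: "normal_logic L' \<Longrightarrow> L \<subseteq> L' \<Longrightarrow> A \<subseteq> L' \<Longrightarrow> L \<oplus> A \<subseteq> L'"
  unfolding normal_ext_def by blast


section \<open>Kripke semantics and S4\<close>

primrec sat :: "'w set \<Rightarrow> 'w rel \<Rightarrow> (nat \<Rightarrow> 'w set) \<Rightarrow> 'w \<Rightarrow> form \<Rightarrow> bool" where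
  "sat W R V x (Atom p) = (x \<in> V p)"
| "sat W R V x Bot = False"
| "sat W R V x Top = True"
| "sat W R V x (Neg \<phi>) = (\<not> sat W R V x \<phi>)"
| "sat W R V x (Box \<phi>) = (\<forall>y\<in>W. (x, y) \<in> R \<longrightarrow> sat W R V y \<phi>)"
| "sat W R V x (And \<phi> \<psi>) = (sat W R V x \<phi> \<and> sat W R V x \<psi>)"
| "sat W R V x (Or \<phi> \<psi>) = (sat W R V x \<phi> \<or> sat W R V x \<psi>)"

definition frame_valid :: "'w set \<Rightarrow> 'w rel \<Rightarrow> form \<Rightarrow> bool" where
  "frame_valid W R \<phi> \<longleftrightarrow> (\<forall>V. \<forall>x\<in>W. sat W R V x \<phi>)"

text \<open>A definition cannot quantify over all carrier types, so only frames carried by sets of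
  natural numbers are mentioned. Nothing is lost: by lemma \<open>S4_valid\<close> below, these formulas
  are valid in all preorders over any carrier type.\<close>

definition S4 :: "form set" where
  "S4 = {\<phi>. \<forall>(W :: nat set) R. preorder_on W R \<longrightarrow> frame_valid W R \<phi>}"

lemma S4_valid:
  fixes W :: "'w set"
  assumes "\<phi> \<in> S4" and pre: "preorder_on W R"
  shows "frame_valid W R \<phi>"
proof (rule ccontr)
  assume "\<not> frame_valid W R \<phi>"
  then obtain V x where x: "x \<in> W" and nsat: "\<not> sat W R V x \<phi>"
    by (auto simp: frame_valid_def)
  define good where "good y \<psi> z \<longleftrightarrow> z \<in> W \<and> (y, z) \<in> R \<and> \<not> sat W R V z \<psi>" for y \<psi> z
  define step where "step y \<psi> = (if \<exists>z. good y \<psi> z then SOME z. good y \<psi> z else y)" for y \<psi>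
  define f where "f = rec_list x (\<lambda>\<psi> _ y. step y \<psi>)"
  have f_simps: "f [] = x" "\<And>\<psi> l. f (\<psi> # l) = step (f l) \<psi>"
    by (simp_all add: f_def)
  have step_good: "good y \<psi> (step y \<psi>)" if "good y \<psi> z" for y \<psi> z
    using that by (auto simp: step_def intro: someI)
  have f_in: "f l \<in> W" for l
  proof (induction l)
    case (Cons \<psi> l)
    then show ?case
      using step_good[of "f l" \<psi>] by (cases "\<exists>z. good (f l) \<psi> z") (auto simp: f_simps step_def good_def)
  qed (simp add: f_simps x)
  define g where "g n = f (from_nat n)" for n :: nat
  define R' where "R' = {(a, b). (g a, g b) \<in> R}"
  define V' where "V' p = {a. g a \<in> V p}" for p
  have pre': "preorder_on (UNIV :: nat set) R'"
    using pre f_in unfolding preorder_on_def R'_def refl_on_def trans_def g_def by auto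
  have "sat UNIV R' V' a \<psi> = sat W R V (g a) \<psi>" for a \<psi>
  proof (induction \<psi> arbitrary: a)
    case (Box \<psi>)
    have "sat W R V (g a) (Box \<psi>)" if *: "sat UNIV R' V' a (Box \<psi>)"
    proof (rule ccontr)
      assume "\<not> sat W R V (g a) (Box \<psi>)"
      then obtain z where "good (g a) \<psi> z"
        by (auto simp: good_def)
      then have "good (g a) \<psi> (g (to_nat (\<psi> # from_nat a)))"
        using step_good by (simp add: g_def f_simps)
      with * Box.IH show False
        by (auto simp: good_def R'_def)
    qed
    moreover have "sat UNIV R' V' a (Box \<psi>)" if "sat W R V (g a) (Box \<psi>)"
      using that Box.IH f_in by (auto simp: R'_def g_def)
    ultimately show ?case
      by blast
  qed (auto simp: V'_def)
  moreover have "g (to_nat ([] :: form list)) = x"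
    by (simp add: g_def f_simps)
  ultimately have "\<not> frame_valid (UNIV :: nat set) R' \<phi>"
    using nsat unfolding frame_valid_def by (metis UNIV_I)
  with pre' \<open>\<phi> \<in> S4\<close> show False
    by (auto simp: S4_def)
qed


section \<open>Superintuitionistic logics\<close>

datatype iform =
    IAtom nat
  | IBot
  | IAnd iform iform
  | IOr iform iform
  | IImp iform iform

abbreviation INeg :: "iform \<Rightarrow> iform" where
  "INeg \<phi> \<equiv> IImp \<phi> IBot"

primrec isubst :: "(nat \<Rightarrow> iform) \<Rightarrow> iform \<Rightarrow> iform" where
  "isubst s (IAtom p) = s p"
| "isubst s IBot = IBot"
| "isubst s (IAnd \<phi> \<psi>) = IAnd (isubst s \<phi>) (isubst s \<psi>)"
| "isubst s (IOr \<phi> \<psi>) = IOr (isubst s \<phi>) (isubst s \<psi>)"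
| "isubst s (IImp \<phi> \<psi>) = IImp (isubst s \<phi>) (isubst s \<psi>)"

inductive_set IntL :: "iform set" where
  ax_K: "IImp \<phi> (IImp \<psi> \<phi>) \<in> IntL"
| ax_S: "IImp (IImp \<phi> (IImp \<psi> \<xi>)) (IImp (IImp \<phi> \<psi>) (IImp \<phi> \<xi>)) \<in> IntL"
| ax_AndE1: "IImp (IAnd \<phi> \<psi>) \<phi> \<in> IntL"
| ax_AndE2: "IImp (IAnd \<phi> \<psi>) \<psi> \<in> IntL"
| ax_AndI: "IImp \<phi> (IImp \<psi> (IAnd \<phi> \<psi>)) \<in> IntL"
| ax_OrI1: "IImp \<phi> (IOr \<phi> \<psi>) \<in> IntL"
| ax_OrI2: "IImp \<psi> (IOr \<phi> \<psi>) \<in> IntL"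
| ax_OrE: "IImp (IImp \<phi> \<xi>) (IImp (IImp \<psi> \<xi>) (IImp (IOr \<phi> \<psi>) \<xi>)) \<in> IntL"
| ax_BotE: "IImp IBot \<phi> \<in> IntL"
| MP: "\<phi> \<in> IntL \<Longrightarrow> IImp \<phi> \<psi> \<in> IntL \<Longrightarrow> \<psi> \<in> IntL"

definition si_logic :: "iform set \<Rightarrow> bool" where
  "si_logic \<Lambda> \<longleftrightarrow>
     IntL \<subseteq> \<Lambda> \<and>
     (\<forall>\<phi> \<psi>. \<phi> \<in> \<Lambda> \<longrightarrow> IImp \<phi> \<psi> \<in> \<Lambda> \<longrightarrow> \<psi> \<in> \<Lambda>) \<and>
     (\<forall>\<phi> s. \<phi> \<in> \<Lambda> \<longrightarrow> isubst s \<phi> \<in> \<Lambda>)"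

definition si_ext :: "iform set \<Rightarrow> iform set \<Rightarrow> iform set" where
  "si_ext \<Lambda> A = \<Inter>{\<Lambda>'. si_logic \<Lambda>' \<and> \<Lambda> \<subseteq> \<Lambda>' \<and> A \<subseteq> \<Lambda>'}"

definition KC :: "iform set" where
  "KC = si_ext IntL {IOr (INeg (IAtom 0)) (INeg (INeg (IAtom 0)))}"


section \<open>Modal companions\<close>

primrec goedel :: "iform \<Rightarrow> form" where
  "goedel (IAtom p) = Box (Atom p)"
| "goedel IBot = Bot"
| "goedel (IAnd \<phi> \<psi>) = And (goedel \<phi>) (goedel \<psi>)"
| "goedel (IOr \<phi> \<psi>) = Or (goedel \<phi>) (goedel \<psi>)"
| "goedel (IImp \<phi> \<psi>) = Box (Imp (goedel \<phi>) (goedel \<psi>))"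

definition modal_companion :: "form set \<Rightarrow> iform set \<Rightarrow> bool" where
  "modal_companion L \<Lambda> \<longleftrightarrow>
     normal_logic L \<and> S4 \<subseteq> L \<and> (\<forall>\<phi>. \<phi> \<in> \<Lambda> \<longleftrightarrow> goedel \<phi> \<in> L)"

definition tau :: "iform set \<Rightarrow> form set" where
  "tau \<Lambda> = (LEAST L. modal_companion L \<Lambda>)"


section \<open>Frame formulas\<close>

definition big_and :: "form list \<Rightarrow> form" where
  "big_and \<phi>s = foldr And \<phi>s Top"

definition big_or :: "form list \<Rightarrow> form" where
  "big_or \<phi>s = foldr Or \<phi>s Bot"

text \<open>\<open>frame_form k R\<close> is the frame formula of the frame on \<open>{0..<k}\<close> with accessibility
  relation \<open>R\<close> and root \<open>0\<close>; only the values of \<open>R\<close> below \<open>k\<close> matter.\<close>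

definition frame_form :: "nat \<Rightarrow> (nat \<Rightarrow> nat \<Rightarrow> bool) \<Rightarrow> form" where
  "frame_form k R = Neg (big_and (
     [Atom 0, Box (big_or (map Atom [0..<k]))] @
     [Box (Imp (Atom i) (Neg (Atom j))). i \<leftarrow> [0..<k], j \<leftarrow> [0..<k], i \<noteq> j] @
     [Box (Imp (Atom i) (Dia (Atom j))). i \<leftarrow> [0..<k], j \<leftarrow> [0..<k], R i j] @
     [Box (Imp (Atom i) (Neg (Dia (Atom j)))). i \<leftarrow> [0..<k], j \<leftarrow> [0..<k], \<not> R i j]))"

text \<open>Clusters of size \<open>k\<close>, without and with a reflexive point strictly above.\<close>

definition cluster_form :: "nat \<Rightarrow> form" where
  "cluster_form k = frame_form k (\<lambda>i j. True)"

definition topped_cluster_form :: "nat \<Rightarrow> form" where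
  "topped_cluster_form k = frame_form (k + 1) (\<lambda>i j. i < k \<or> (i = k \<and> j = k))"

definition gam :: "enat \<Rightarrow> form" where
  "gam n = (case n of enat n \<Rightarrow> cluster_form (n + 1) | \<infinity> \<Rightarrow> Top)"

definition gam_bar :: "enat \<Rightarrow> form" where
  "gam_bar n = (case n of enat n \<Rightarrow> topped_cluster_form (n + 1) | \<infinity> \<Rightarrow> Top)"

definition Gam :: "iform set \<Rightarrow> enat \<Rightarrow> enat \<Rightarrow> form set" where
  "Gam \<Lambda> m n = tau \<Lambda> \<oplus> {gam m} \<oplus> {gam_bar n}"


section \<open>Craig interpolation\<close>

definition craig_interpolation :: "form set \<Rightarrow> bool" where
  "craig_interpolation L \<longleftrightarrow>
     (\<forall>\<phi> \<psi>. Imp \<phi> \<psi> \<in> L \<longrightarrow>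
        (\<exists>\<chi>. atoms \<chi> \<subseteq> atoms \<phi> \<inter> atoms \<psi> \<and> Imp \<phi> \<chi> \<in> L \<and> Imp \<chi> \<psi> \<in> L))"

end

theory Submission
  imports Defs
begin

text \<open>
  A failure of interpolation for \<open>\<phi> \<rightarrow> \<psi>\<close> yields a pair \<open>(s, t)\<close> of maximal consistent sets with
  \<open>\<phi> \<in> s\<close> and \<open>\<psi> \<notin> t\<close> that agree on all formulas in the common atoms. All such pairs, ordered
  componentwise, form a preorder in which both projections to the canonical model are bounded
  morphisms; but it need not validate the frame formulas. By compactness, above every pair containing a
  formula there is a maximal such pair, and the frame formulas bound the canonical cluster of a
  maximal point by \<open>m\<close> if it is final and by \<open>n\<close> otherwise. It therefore suffices to keep the
  clusters of pairs that are maximal for one of finitely many formulas, and from each of them only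
  a subset that projects onto the bounded components. A cluster of pairs is a rectangular relation
  between its components, so such a subset of size at most \<open>m\<close> or \<open>n\<close> exists when the bound is
  \<open>1\<close>, \<open>2\<close> or \<open>\<omega>\<close>. The resulting frame has bounded depth, hence validates the logic, and it
  refutes \<open>\<phi> \<rightarrow> \<psi>\<close>.
\<close>

section \<open>Semantics\<close>

lemma sat_big_and: "sat W R V x (big_and xs) \<longleftrightarrow> (\<forall>\<phi>\<in>set xs. sat W R V x \<phi>)"
  by (induction xs) (auto simp: big_and_def)

lemma sat_big_or: "sat W R V x (big_or xs) \<longleftrightarrow> (\<exists>\<phi>\<in>set xs. sat W R V x \<phi>)"
  by (induction xs) (auto simp: big_or_def)

text \<open>If \<open>R\<close> is a preorder and \<open>Q\<close> a preorder with root 0, a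
  refutation at \<open>x\<close> is a bounded morphism from the cone of \<open>x\<close> onto
  \<open>Q\<close>. Frame formulas are handled below only in this semantic form.\<close>

lemma sat_frame_form:
  "sat W R V x (frame_form k Q) \<longleftrightarrow>
     \<not> (x \<in> V 0 \<and> (\<forall>y\<in>W. (x, y) \<in> R \<longrightarrow> (\<exists>i<k. y \<in> V i)) \<and>
        (\<forall>i<k. \<forall>j<k. i \<noteq> j \<longrightarrow> (\<forall>y\<in>W. (x, y) \<in> R \<longrightarrow> y \<in> V i \<longrightarrow> y \<notin> V j)) \<and>
        (\<forall>i<k. \<forall>j<k. Q i j \<longrightarrow>
           (\<forall>y\<in>W. (x, y) \<in> R \<longrightarrow> y \<in> V i \<longrightarrow> (\<exists>z\<in>W. (y, z) \<in> R \<and> z \<in> V j))) \<and>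
        (\<forall>i<k. \<forall>j<k. \<not> Q i j \<longrightarrow>
           (\<forall>y\<in>W. (x, y) \<in> R \<longrightarrow> y \<in> V i \<longrightarrow> (\<forall>z\<in>W. (y, z) \<in> R \<longrightarrow> z \<notin> V j))))"
proof -
  have *: "(\<forall>\<phi>\<in>set (concat (map (\<lambda>i. concat (map (\<lambda>j. if P i j then [f i j] else []) [0..<k])) [0..<k])).
      sat W R V x \<phi>) \<longleftrightarrow> (\<forall>i<k. \<forall>j<k. P i j \<longrightarrow> sat W R V x (f i j))" for P f
    by fastforce
  show ?thesis
    unfolding frame_form_def
    by (simp add: sat_big_and sat_big_or ball_Un * del: set_concat set_map set_upt)
       (auto simp: sat_big_or)
qed

lemma sat_subst: "sat W R V x (subst s \<phi>) \<longleftrightarrow> sat W R (\<lambda>p. {y. sat W R V y (s p)}) x \<phi>"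
  by (induction \<phi> arbitrary: x) auto

lemma tval_sat: "tval (\<lambda>\<phi>. sat W R V x \<phi>) \<phi> = sat W R V x \<phi>"
  by (induction \<phi>) auto

lemma normal_logic_frame_valid: "normal_logic {\<phi>. frame_valid W R \<phi>}"
proof -
  have "frame_valid W R \<phi>" if "tautology \<phi>" for \<phi>
    using that tval_sat unfolding tautology_def frame_valid_def by metis
  moreover have "frame_valid W R (subst s \<phi>)" if "frame_valid W R \<phi>" for s \<phi>
    using that by (simp add: frame_valid_def sat_subst)
  ultimately show ?thesis
    by (auto simp: normal_logic_def) (auto simp: frame_valid_def)
qed

lemma S4_I:
  assumes "\<And>(W :: nat set) R V x. preorder_on W R \<Longrightarrow> x \<in> W \<Longrightarrow> sat W R V x \<phi>"
  shows "\<phi> \<in> S4"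
  using assms by (auto simp: S4_def frame_valid_def)

lemma preorder_on_refl: "preorder_on W R \<Longrightarrow> x \<in> W \<Longrightarrow> (x, x) \<in> R"
  by (auto simp: preorder_on_def refl_on_def)

lemma preorder_on_trans: "preorder_on W R \<Longrightarrow> (x, y) \<in> R \<Longrightarrow> (y, z) \<in> R \<Longrightarrow> (x, z) \<in> R"
  by (auto simp: preorder_on_def dest: transD)

lemma normal_logic_S4: "normal_logic S4"
proof -
  let ?v = "\<lambda>(W :: nat set) R. {\<phi>. frame_valid W R \<phi>}"
  have "S4 = \<Inter>{?v W R | W R. preorder_on W R}"
    by (auto simp: S4_def)
  moreover have "normal_logic (\<Inter>{?v W R | W R. preorder_on W R})"
    using normal_logic_frame_valid unfolding normal_logic_def by blast
  ultimately show ?thesis by simp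
qed

text \<open>The Geach axiom, which yields S4.2 over \<open>S4\<close>.\<close>

definition dot2 :: form where
  "dot2 = Imp (Dia (Box (Atom 0))) (Box (Dia (Atom 0)))"

definition confluent :: "'w set \<Rightarrow> 'w rel \<Rightarrow> bool" where
  "confluent W R \<longleftrightarrow> (\<forall>x\<in>W. \<forall>y\<in>W. \<forall>z\<in>W. (x, y) \<in> R \<longrightarrow> (x, z) \<in> R \<longrightarrow>
     (\<exists>u\<in>W. (y, u) \<in> R \<and> (z, u) \<in> R))"

lemma confluent_dot2: "confluent W R \<Longrightarrow> frame_valid W R dot2"
  unfolding confluent_def frame_valid_def dot2_def by simp blast


section \<open>Smallest modal companions of \<open>IntL\<close> and \<open>KC\<close>\<close>

text \<open>Atoms and implications are translated to boxed formulas, which persist along a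
  transitive relation; conjunction and disjunction preserve persistence.\<close>

lemma goedel_persistent:
  assumes "preorder_on W R"
  shows "sat W R V x (goedel \<phi>) \<Longrightarrow> (x, y) \<in> R \<Longrightarrow> sat W R V y (goedel \<phi>)"
  by (induction \<phi> arbitrary: x y) (auto intro: preorder_on_trans[OF assms])

text \<open>The two formulas differ only at atoms, where the left one carries an extra
  \<open>Box\<close>; persistence and reflexivity absorb it.\<close>

lemma sat_goedel_isubst:
  assumes pre: "preorder_on W R"
  shows "x \<in> W \<Longrightarrow>
    sat W R V x (subst (\<lambda>p. goedel (s p)) (goedel \<phi>)) = sat W R V x (goedel (isubst s \<phi>))"
proof (induction \<phi> arbitrary: x)
  case (IAtom p)
  then show ?case
    using goedel_persistent[OF pre] preorder_on_refl[OF pre] by auto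
qed auto

lemma goedel_IntL: "\<phi> \<in> IntL \<Longrightarrow> goedel \<phi> \<in> S4"
proof (induction rule: IntL.induct)
  case (MP \<phi> \<psi>)
  show ?case
  proof (rule S4_I)
    fix W :: "nat set" and R V x
    assume *: "preorder_on W R" "x \<in> W"
    then have "sat W R V x (goedel \<phi>)" "sat W R V x (goedel (IImp \<phi> \<psi>))"
      using MP by (auto simp: S4_def frame_valid_def)
    then show "sat W R V x (goedel \<psi>)"
      using preorder_on_refl[OF *] * by auto
  qed
qed (rule S4_I; simp; meson goedel_persistent preorder_on_trans preorder_on_refl)+

section \<open>Prime theories of intuitionistic logics\<close>

text \<open>Modus ponens is the only rule, as the deduction theorem requires. Closure under
  substitution is left to the set \<open>L\<close> of axioms.\<close>

inductive ided :: "iform set \<Rightarrow> iform set \<Rightarrow> iform \<Rightarrow> bool" for L A where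
  ax: "\<phi> \<in> L \<Longrightarrow> ided L A \<phi>"
| hyp: "\<phi> \<in> A \<Longrightarrow> ided L A \<phi>"
| mp: "ided L A \<phi> \<Longrightarrow> ided L A (IImp \<phi> \<psi>) \<Longrightarrow> ided L A \<psi>"

lemma ided_mono: "ided L A \<phi> \<Longrightarrow> A \<subseteq> B \<Longrightarrow> ided L B \<phi>"
  by (induction rule: ided.induct) (auto intro: ided.intros)

text \<open>A derivation uses finitely many hypotheses: at each modus ponens the larger of two
  members of the chain serves both premises.\<close>

lemma ided_Union_chain:
  assumes "ided L (\<Union>C) \<phi>" "C \<noteq> {}" "\<And>A B. A \<in> C \<Longrightarrow> B \<in> C \<Longrightarrow> A \<subseteq> B \<or> B \<subseteq> A"
  shows "\<exists>A\<in>C. ided L A \<phi>"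
  using assms(1)
proof (induction rule: ided.induct)
  case (mp \<phi> \<psi>)
  then obtain A B where "A \<in> C" "B \<in> C" "ided L A \<phi>" "ided L B (IImp \<phi> \<psi>)" by blast
  then show ?case
    using assms(3)[of A B] by (meson ided.mp ided_mono)
qed (use assms(2) in \<open>auto intro: ided.intros\<close>)

locale int_theory =
  fixes L :: "iform set"
  assumes IntL_sub: "IntL \<subseteq> L"
    and L_mp: "\<phi> \<in> L \<Longrightarrow> IImp \<phi> \<psi> \<in> L \<Longrightarrow> \<psi> \<in> L"
begin

abbreviation ider :: "iform set \<Rightarrow> iform \<Rightarrow> bool" (infix "\<turnstile>" 50) where
  "A \<turnstile> \<phi> \<equiv> ided L A \<phi>"

lemma ided_IntL: "\<phi> \<in> IntL \<Longrightarrow> A \<turnstile> \<phi>"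
  using IntL_sub by (auto intro: ided.ax)

lemma ided_K: "A \<turnstile> \<phi> \<Longrightarrow> A \<turnstile> IImp \<psi> \<phi>"
  by (blast intro: ided.mp ided_IntL IntL.ax_K)

lemma ided_refl: "A \<turnstile> IImp \<phi> \<phi>"
  by (rule ided.mp[OF _ ided.mp[OF _ ided_IntL[OF IntL.ax_S]]]) (rule ided_IntL[OF IntL.ax_K])+

lemma ided_deduction: "insert \<alpha> A \<turnstile> \<phi> \<Longrightarrow> A \<turnstile> IImp \<alpha> \<phi>"
proof (induction rule: ided.induct)
  case (mp \<phi> \<psi>)
  then show ?case
    by (blast intro: ided.mp ided_IntL IntL.ax_S)
qed (auto intro: ided_refl ided_K ided.intros)

lemma ided_empty: "{} \<turnstile> \<phi> \<Longrightarrow> \<phi> \<in> L"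
  by (induction rule: ided.induct) (auto intro: L_mp)

lemma ided_IAnd: "A \<turnstile> \<phi> \<Longrightarrow> A \<turnstile> \<psi> \<Longrightarrow> A \<turnstile> IAnd \<phi> \<psi>"
  by (blast intro: ided.mp ided_IntL IntL.ax_AndI)

lemma ided_IOrE: "insert \<phi> A \<turnstile> \<xi> \<Longrightarrow> insert \<psi> A \<turnstile> \<xi> \<Longrightarrow> A \<turnstile> IOr \<phi> \<psi> \<Longrightarrow> A \<turnstile> \<xi>"
  by (meson ided_deduction ided.mp ided_IntL IntL.ax_OrE)

definition prime_th :: "iform set \<Rightarrow> bool" where
  "prime_th G \<longleftrightarrow> (\<forall>\<phi>. G \<turnstile> \<phi> \<longrightarrow> \<phi> \<in> G) \<and> IBot \<notin> G \<and>
     (\<forall>\<phi> \<psi>. IOr \<phi> \<psi> \<in> G \<longrightarrow> \<phi> \<in> G \<or> \<psi> \<in> G)"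

text \<open>Zorn's lemma gives a set maximal among those not deriving \<open>\<phi>\<close>. Any
  further formula would make \<open>\<phi>\<close> derivable, so disjunction elimination yields
  primeness.\<close>

lemma prime_extension:
  assumes "\<not> A \<turnstile> \<phi>"
  obtains G where "prime_th G" "A \<subseteq> G" "\<phi> \<notin> G"
proof -
  let ?X = "{B. A \<subseteq> B \<and> \<not> B \<turnstile> \<phi>}"
  have "\<exists>M\<in>?X. \<forall>X\<in>?X. M \<subseteq> X \<longrightarrow> X = M"
  proof (rule subset_Zorn)
    fix C assume C: "subset.chain ?X C"
    show "\<exists>U\<in>?X. \<forall>X\<in>C. X \<subseteq> U"
    proof (cases "C = {}")
      case False
      then have "\<not> \<Union>C \<turnstile> \<phi>"
        using C ided_Union_chain[of L C \<phi>] unfolding subset.chain_def subset_chain_def by blast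
      moreover have "A \<subseteq> \<Union>C"
        using C False unfolding subset.chain_def by blast
      ultimately show ?thesis by blast
    qed (use assms in auto)
  qed
  then obtain M where M: "A \<subseteq> M" "\<not> M \<turnstile> \<phi>" and max: "\<And>X. M \<subseteq> X \<Longrightarrow> \<not> X \<turnstile> \<phi> \<Longrightarrow> X = M"
    by (smt (verit) mem_Collect_eq subset_trans)
  have max': "insert \<psi> M \<turnstile> \<phi>" if "\<psi> \<notin> M" for \<psi>
    using max[of "insert \<psi> M"] that by blast
  have closed: "\<psi> \<in> M" if "M \<turnstile> \<psi>" for \<psi>
    using max'[of \<psi>] that M(2) by (meson ided.mp ided_deduction)
  have "IBot \<notin> M"
    using M(2) by (meson IntL.ax_BotE ided.hyp ided.mp ided_IntL)
  moreover have "\<psi> \<in> M \<or> \<xi> \<in> M" if "IOr \<psi> \<xi> \<in> M" for \<psi> \<xi>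
    using max' ided_IOrE that M(2) ided.hyp by blast
  ultimately have "prime_th M"
    using closed by (auto simp: prime_th_def)
  with M show thesis
    using that ided.hyp by blast
qed

definition prime_rel :: "iform set rel" where
  "prime_rel = {(G, H). prime_th G \<and> prime_th H \<and> G \<subseteq> H}"

lemma preorder_prime_rel: "preorder_on {G. prime_th G} prime_rel"
  by (auto simp: preorder_on_def prime_rel_def refl_on_def intro: transI)

text \<open>Truth lemma of the canonical intuitionistic model, read modally. Only implication calls
  for new theories, supplied by \<open>prime_extension\<close>.\<close>

lemma sat_goedel_prime:
  "prime_th G \<Longrightarrow> sat {G. prime_th G} prime_rel (\<lambda>p. {G. IAtom p \<in> G}) G (goedel \<phi>) \<longleftrightarrow> \<phi> \<in> G"
proof (induction \<phi> arbitrary: G)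
  case (IAnd \<phi> \<psi>)
  have "IAnd \<phi> \<psi> \<in> G \<longleftrightarrow> \<phi> \<in> G \<and> \<psi> \<in> G"
    using IAnd.prems unfolding prime_th_def
    by (meson ided_IAnd ided.hyp ided.mp ided_IntL IntL.ax_AndE1 IntL.ax_AndE2)
  then show ?case using IAnd by simp
next
  case (IOr \<phi> \<psi>)
  have "IOr \<phi> \<psi> \<in> G \<longleftrightarrow> \<phi> \<in> G \<or> \<psi> \<in> G"
    using IOr.prems unfolding prime_th_def
    by (meson ided.hyp ided.mp ided_IntL IntL.ax_OrI1 IntL.ax_OrI2)
  then show ?case using IOr by simp
next
  case (IImp \<phi> \<psi>)
  have "\<psi> \<in> H" if "IImp \<phi> \<psi> \<in> G" "\<phi> \<in> H" "prime_th H" "G \<subseteq> H" for H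
    using that unfolding prime_th_def by (meson ided.hyp ided.mp subsetD)
  moreover have "\<exists>H. prime_th H \<and> G \<subseteq> H \<and> \<phi> \<in> H \<and> \<psi> \<notin> H" if "IImp \<phi> \<psi> \<notin> G"
  proof -
    have "\<not> insert \<phi> G \<turnstile> \<psi>"
      using that IImp.prems ided_deduction by (auto simp: prime_th_def)
    then show ?thesis
      by (rule prime_extension) blast
  qed
  ultimately have "IImp \<phi> \<psi> \<in> G \<longleftrightarrow> (\<forall>H. prime_th H \<longrightarrow> G \<subseteq> H \<longrightarrow> \<phi> \<in> H \<longrightarrow> \<psi> \<in> H)"
    using IImp.prems by blast
  moreover have "sat {G. prime_th G} prime_rel (\<lambda>p. {G. IAtom p \<in> G}) G (goedel (IImp \<phi> \<psi>)) \<longleftrightarrow>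
      (\<forall>H. prime_th H \<longrightarrow> G \<subseteq> H \<longrightarrow> \<phi> \<in> H \<longrightarrow> \<psi> \<in> H)"
    using IImp by (auto simp: prime_rel_def)
  ultimately show ?case
    by blast
qed (auto simp: prime_th_def prime_rel_def)

lemma prime_frame_refutes:
  assumes "\<phi> \<notin> L"
  shows "\<not> frame_valid {G. prime_th G} prime_rel (goedel \<phi>)"
proof -
  obtain G where "prime_th G" "\<phi> \<notin> G"
    using ided_empty assms by (meson prime_extension)
  then show ?thesis
    using sat_goedel_prime[of G \<phi>] unfolding frame_valid_def by (metis mem_Collect_eq)
qed

text \<open>Two prime theories \<open>H\<close> and \<open>K\<close> above \<open>G\<close> have a
  consistent union: an inconsistency would reduce to one \<open>a\<close> in \<open>K\<close> with
  \<open>INeg a\<close> in \<open>H\<close>, while weak excluded middle for \<open>a\<close> in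
  \<open>G\<close> puts \<open>INeg a\<close> into \<open>K\<close> or \<open>INeg (INeg a)\<close>
  into \<open>H\<close>.\<close>

lemma confluent_prime_rel:
  assumes wem: "\<And>\<phi>. IOr (INeg \<phi>) (INeg (INeg \<phi>)) \<in> L"
  shows "confluent {G. prime_th G} prime_rel"
proof -
  have "\<exists>u. prime_th u \<and> H \<subseteq> u \<and> K \<subseteq> u"
    if G: "prime_th G" and H: "prime_th H" "G \<subseteq> H" and K: "prime_th K" "G \<subseteq> K" for G H K
  proof -
    \<comment> \<open>Hypotheses from \<open>K\<close> merge into a single one because
      \<open>K\<close> is closed under conjunction.\<close>
    have red: "\<exists>\<chi>\<in>K. H \<turnstile> IImp \<chi> \<theta>" if "H \<union> K \<turnstile> \<theta>" for \<theta>
      using that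
    proof (induction rule: ided.induct)
      case (mp \<phi> \<psi>)
      then obtain a b where ab: "a \<in> K" "b \<in> K" "H \<turnstile> IImp a \<phi>" "H \<turnstile> IImp b (IImp \<phi> \<psi>)"
        by blast
      let ?H = "insert (IAnd a b) H"
      have "?H \<turnstile> IAnd a b"
        by (rule ided.hyp) simp
      then have "?H \<turnstile> a" "?H \<turnstile> b"
        using ided_IntL[OF IntL.ax_AndE1] ided_IntL[OF IntL.ax_AndE2] by (blast intro: ided.mp)+
      moreover have "?H \<turnstile> IImp a \<phi>" "?H \<turnstile> IImp b (IImp \<phi> \<psi>)"
        using ab(3,4) by (auto intro: ided_mono)
      ultimately have "?H \<turnstile> \<psi>"
        by (blast intro: ided.mp)
      moreover have "IAnd a b \<in> K"
        using ab K by (auto simp: prime_th_def intro: ided_IAnd ided.hyp)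
      ultimately show ?case
        by (blast intro: ided_deduction)
    next
      case (ax \<phi>)
      then have "\<phi> \<in> K"
        using K by (auto simp: prime_th_def intro: ided.ax)
      then show ?case using ided_refl by blast
    next
      case (hyp \<phi>)
      \<comment> \<open>A theorem serves as a dummy member of \<open>K\<close> when the hypothesis
        comes from \<open>H\<close>.\<close>
      moreover have "INeg IBot \<in> K"
        using K ided_refl by (auto simp: prime_th_def)
      ultimately show ?case
        using ided_refl by (blast intro: ided_K ided.hyp)
    qed
    have "\<not> H \<union> K \<turnstile> IBot"
    proof
      assume "H \<union> K \<turnstile> IBot"
      then obtain a where a: "a \<in> K" "INeg a \<in> H"
        using red H unfolding prime_th_def by blast
      have "IOr (INeg a) (INeg (INeg a)) \<in> G"
        using wem[of a] G by (auto simp: prime_th_def intro: ided.ax)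
      then consider "INeg a \<in> K" | "INeg (INeg a) \<in> H"
        using G H K unfolding prime_th_def by blast
      then show False
        using a H(1) K(1) unfolding prime_th_def by cases (meson ided.hyp ided.mp)+
    qed
    then show ?thesis
      by (rule prime_extension) blast
  qed
  then show ?thesis
    by (auto simp: confluent_def prime_rel_def)
qed

end

section \<open>Computation of the two smallest companions\<close>

text \<open>Minimality is immediate, since every companion contains \<open>S4\<close>. That
  \<open>S4\<close> is a companion holds because the prime theories form a preorder refuting each
  non-theorem.\<close>

lemma tau_IntL: "tau IntL = S4"
  unfolding tau_def
proof (rule Least_equality)
  interpret int_theory IntL
    by unfold_locales (auto intro: IntL.MP)
  have "\<phi> \<in> IntL" if "goedel \<phi> \<in> S4" for \<phi>
    using S4_valid[OF that preorder_prime_rel] prime_frame_refutes[of \<phi>] by argo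
  with goedel_IntL have "\<phi> \<in> IntL \<longleftrightarrow> goedel \<phi> \<in> S4" for \<phi>
    by metis
  with normal_logic_S4 show "modal_companion S4 IntL"
    by (simp add: modal_companion_def)
qed (simp add: modal_companion_def)

lemma si_logic_mp: "si_logic \<Lambda> \<Longrightarrow> \<phi> \<in> \<Lambda> \<Longrightarrow> IImp \<phi> \<psi> \<in> \<Lambda> \<Longrightarrow> \<psi> \<in> \<Lambda>"
  unfolding si_logic_def by blast

lemma si_logic_isubst: "si_logic \<Lambda> \<Longrightarrow> \<phi> \<in> \<Lambda> \<Longrightarrow> isubst s \<phi> \<in> \<Lambda>"
  unfolding si_logic_def by blast

lemma si_logic_IntL: "si_logic \<Lambda> \<Longrightarrow> IntL \<subseteq> \<Lambda>"
  unfolding si_logic_def by blast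

lemma mem_KC_iff:
  "\<phi> \<in> KC \<longleftrightarrow> (\<forall>\<Lambda>. si_logic \<Lambda> \<longrightarrow> IOr (INeg (IAtom 0)) (INeg (INeg (IAtom 0))) \<in> \<Lambda> \<longrightarrow> \<phi> \<in> \<Lambda>)"
  by (auto simp: KC_def si_ext_def dest: si_logic_IntL)

lemma si_logic_KC: "si_logic KC"
  unfolding si_logic_def[of KC]
  by (meson si_logic_mp si_logic_isubst si_logic_IntL mem_KC_iff subset_iff)

lemma KC_wem: "IOr (INeg \<phi>) (INeg (INeg \<phi>)) \<in> KC"
proof -
  have "IOr (INeg (IAtom 0)) (INeg (INeg (IAtom 0))) \<in> KC"
    by (simp add: mem_KC_iff)
  from si_logic_isubst[OF si_logic_KC this, of "\<lambda>_. \<phi>"] show ?thesis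
    by simp
qed

lemma normal_logic_mp: "normal_logic L \<Longrightarrow> Imp \<phi> \<psi> \<in> L \<Longrightarrow> \<phi> \<in> L \<Longrightarrow> \<psi> \<in> L"
  unfolding normal_logic_def by blast

lemma normal_logic_subst: "normal_logic L \<Longrightarrow> \<phi> \<in> L \<Longrightarrow> subst s \<phi> \<in> L"
  unfolding normal_logic_def by blast

lemma normal_ext_base: "L \<subseteq> L \<oplus> A" and normal_ext_new: "A \<subseteq> L \<oplus> A"
  unfolding normal_ext_def by blast+

text \<open>Used to embed \<open>KC\<close> by translation: as \<open>KC\<close> is the least logic
  with its axiom, only the translated axiom has to be checked. Closure under substitution rests on
  \<open>sat_goedel_isubst\<close>.\<close>

lemma si_logic_goedel_preimage:
  assumes L: "normal_logic L" "S4 \<subseteq> L"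
  shows "si_logic {\<phi>. goedel \<phi> \<in> L}"
proof -
  have "goedel \<psi> \<in> L" if "goedel \<phi> \<in> L" "goedel (IImp \<phi> \<psi>) \<in> L" for \<phi> \<psi>
  proof -
    have "Imp (goedel (IImp \<phi> \<psi>)) (Imp (goedel \<phi>) (goedel \<psi>)) \<in> S4"
      by (rule S4_I) (auto dest: preorder_on_refl)
    then show ?thesis
      using that L by (blast intro: normal_logic_mp)
  qed
  moreover have "goedel (isubst s \<phi>) \<in> L" if "goedel \<phi> \<in> L" for s \<phi>
  proof -
    have "Imp (subst (\<lambda>p. goedel (s p)) (goedel \<phi>)) (goedel (isubst s \<phi>)) \<in> S4"
      by (rule S4_I) (auto simp: sat_goedel_isubst)
    then show ?thesis
      using that L by (blast intro: normal_logic_mp normal_logic_subst)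
  qed
  ultimately show ?thesis
    using L(2) goedel_IntL unfolding si_logic_def by blast
qed

text \<open>Over \<open>S4\<close>, the translated axiom of \<open>KC\<close> and
  \<open>dot2\<close> yield each other in a normal logic, and the confluent frame of prime theories
  refutes the translations of non-theorems of \<open>KC\<close>.\<close>

lemma tau_KC: "tau KC = S4 \<oplus> {dot2}"
  unfolding tau_def
proof (rule Least_equality)
  let ?wem = "IOr (INeg (IAtom 0)) (INeg (INeg (IAtom 0)))" and ?L = "S4 \<oplus> {dot2}"
  have L: "normal_logic ?L" "S4 \<subseteq> ?L" "dot2 \<in> ?L"
    using normal_ext_normal normal_ext_base normal_ext_new by blast+
  interpret int_theory KC
    using si_logic_KC by unfold_locales (blast dest: si_logic_IntL si_logic_mp)+
  have "\<phi> \<in> KC" if "goedel \<phi> \<in> ?L" for \<phi>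
  proof (rule ccontr)
    assume "\<phi> \<notin> KC"
    let ?v = "{\<phi>. frame_valid {G. prime_th G} prime_rel \<phi>}"
    have "?L \<subseteq> ?v"
      using S4_valid[OF _ preorder_prime_rel] confluent_dot2[OF confluent_prime_rel[OF KC_wem]]
      by (intro normal_ext_minimal normal_logic_frame_valid) auto
    then show False
      using prime_frame_refutes[OF \<open>\<phi> \<notin> KC\<close>] that by blast
  qed
  moreover have "KC \<subseteq> {\<phi>. goedel \<phi> \<in> ?L}"
  proof -
    \<comment> \<open>Boxing the atom in \<open>dot2\<close> gives the translated axiom, since the
      translation boxes atoms.\<close>
    have "Imp (subst (\<lambda>_. Box (Atom 0)) dot2) (goedel ?wem) \<in> S4"
      by (rule S4_I) (simp add: dot2_def, meson preorder_on_trans preorder_on_refl)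
    then have "goedel ?wem \<in> ?L"
      using L by (blast intro: normal_logic_mp normal_logic_subst)
    then have "?wem \<in> {\<phi>. goedel \<phi> \<in> ?L}"
      by blast
    then show ?thesis
      using si_logic_goedel_preimage[OF L(1,2)] mem_KC_iff by blast
  qed
  ultimately show "modal_companion ?L KC"
    using L by (auto simp: modal_companion_def)
  fix L assume *: "modal_companion L KC"
  then have "goedel ?wem \<in> L"
    using KC_wem unfolding modal_companion_def by blast
  \<comment> \<open>The first disjunct of the translated axiom contradicts the premise of
    \<open>dot2\<close>; the second gives its conclusion by reflexivity.\<close>
  moreover have "Imp (goedel ?wem) dot2 \<in> S4"
    by (rule S4_I) (simp add: dot2_def, meson preorder_on_trans preorder_on_refl)
  ultimately have "dot2 \<in> L"
    using * by (auto simp: modal_companion_def intro: normal_logic_mp)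
  then show "?L \<subseteq> L"
    using * by (intro normal_ext_minimal) (auto simp: modal_companion_def)
qed

section \<open>Frames with bounded clusters\<close>

text \<open>Quantifying over finite subsets gives infinite sets their proper size, where
  \<open>card\<close> would report 0, and makes \<open>\<infinity>\<close> no bound at all.\<close>

definition size_le :: "enat \<Rightarrow> 'a set \<Rightarrow> bool" where
  "size_le k S \<longleftrightarrow> (\<forall>F. finite F \<longrightarrow> F \<subseteq> S \<longrightarrow> enat (card F) \<le> k)"

lemma size_le_mono: "size_le k S \<Longrightarrow> T \<subseteq> S \<Longrightarrow> size_le k T"
  by (auto simp: size_le_def)

lemma size_le_infinity: "size_le \<infinity> S"
  by (simp add: size_le_def)

lemma size_leD: "size_le k S \<Longrightarrow> finite F \<Longrightarrow> F \<subseteq> S \<Longrightarrow> enat (card F) \<le> k"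
  by (simp add: size_le_def)

lemma size_le_card: "finite S \<Longrightarrow> enat (card S) \<le> k \<Longrightarrow> size_le k S"
  unfolding size_le_def by (meson card_mono enat_ord_simps(1) order_trans)

lemma size_le_inj:
  assumes "size_le (enat k) S" "\<And>i. i < Suc k \<Longrightarrow> z i \<in> S" "inj_on z {..<Suc k}"
  shows False
  using size_leD[OF assms(1), of "z ` {..<Suc k}"] assms(2,3) by (auto simp: card_image)

lemma not_size_le_inj:
  assumes "\<not> size_le (enat k) S"
  obtains z :: "nat \<Rightarrow> 'a" where "\<And>i. i < Suc k \<Longrightarrow> z i \<in> S" "inj_on z {..<Suc k}"
proof -
  obtain F where F: "finite F" "F \<subseteq> S" "Suc k \<le> card F"
    using assms by (auto simp: size_le_def not_le)
  obtain G where G: "G \<subseteq> F" "card G = Suc k"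
    using obtain_subset_with_card_n[OF F(3)] by blast
  then obtain z where "bij_betw z {0..<Suc k} G"
    using ex_bij_betw_nat_finite[of G] F(1) finite_subset by metis
  then show thesis
    using that[of z] G F(2) unfolding bij_betw_def lessThan_atLeast0 by force
qed

definition cluster :: "'w set \<Rightarrow> 'w rel \<Rightarrow> 'w \<Rightarrow> 'w set" where
  "cluster W R x = {y \<in> W. (x, y) \<in> R \<and> (y, x) \<in> R}"

definition final :: "'w set \<Rightarrow> 'w rel \<Rightarrow> 'w \<Rightarrow> bool" where
  "final W R x \<longleftrightarrow> (\<forall>y\<in>W. (x, y) \<in> R \<longrightarrow> (y, x) \<in> R)"

lemma minimal_rank:
  fixes rk :: "'w \<Rightarrow> nat"
  assumes "P x"
  obtains y where "P y" "\<And>z. P z \<Longrightarrow> \<not> rk z < rk y"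
  using assms wf_eq_minimal[THEN iffD1, OF wf_measure[of rk]] by (metis in_measure mem_Collect_eq)

text \<open>For \<open>m = enat k\<close>, a refutation gives the points above \<open>x\<close> one
  of \<open>Suc k\<close> disjoint labels, each visible from all these points. One of least rank is
  final, so it sees all labels inside its own cluster, which is then too large.\<close>

lemma frame_valid_gam:
  fixes rk :: "'w \<Rightarrow> nat"
  assumes pre: "preorder_on W R"
    and rk: "\<And>x y. x \<in> W \<Longrightarrow> y \<in> W \<Longrightarrow> (x, y) \<in> R \<Longrightarrow> (y, x) \<notin> R \<Longrightarrow> rk y < rk x"
    and size: "\<And>x. x \<in> W \<Longrightarrow> final W R x \<Longrightarrow> size_le m (cluster W R x)"
  shows "frame_valid W R (gam m)"
proof (cases m)
  case (enat k)
  have "sat W R V x (frame_form (Suc k) (\<lambda>i j. True))" if x: "x \<in> W" for V x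
  proof (rule ccontr)
    assume "\<not> ?thesis"
    then have disj: "\<And>i j y. i < Suc k \<Longrightarrow> j < Suc k \<Longrightarrow> i \<noteq> j \<Longrightarrow> y \<in> W \<Longrightarrow> (x, y) \<in> R \<Longrightarrow>
          y \<in> V i \<Longrightarrow> y \<notin> V j"
      and cover: "\<And>y. y \<in> W \<Longrightarrow> (x, y) \<in> R \<Longrightarrow> \<exists>i<Suc k. y \<in> V i"
      and see: "\<And>i j y. i < Suc k \<Longrightarrow> j < Suc k \<Longrightarrow> y \<in> W \<Longrightarrow> (x, y) \<in> R \<Longrightarrow>
          y \<in> V i \<Longrightarrow> \<exists>z\<in>W. (y, z) \<in> R \<and> z \<in> V j"
      unfolding sat_frame_form not_not by meson+
    obtain y where y: "y \<in> W" "(x, y) \<in> R"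
      and min: "\<And>z. z \<in> W \<and> (x, z) \<in> R \<Longrightarrow> \<not> rk z < rk y"
      using minimal_rank[of "\<lambda>y. y \<in> W \<and> (x, y) \<in> R" x rk] x preorder_on_refl[OF pre x] by blast
    have fin: "final W R y"
      using min y rk preorder_on_trans[OF pre] unfolding final_def by blast
    have "\<exists>z\<in>W. (y, z) \<in> R \<and> z \<in> V i" if "i < Suc k" for i
      using cover[OF y] see that y by blast
    then obtain z where z: "\<And>i. i < Suc k \<Longrightarrow> z i \<in> W \<and> (y, z i) \<in> R \<and> z i \<in> V i"
      by metis
    show False
    proof (rule size_le_inj)
      show "size_le (enat k) (cluster W R y)"
        using size[OF y(1) fin] enat by simp
      show "z i \<in> cluster W R y" if "i < Suc k" for i
        using z[OF that] fin by (auto simp: cluster_def final_def)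
      show "inj_on z {..<Suc k}"
        using z disj preorder_on_trans[OF pre y(2)] unfolding inj_on_def by (metis lessThan_iff)
    qed
  qed
  then show ?thesis
    by (simp add: enat gam_def cluster_form_def frame_valid_def)
qed (simp add: gam_def frame_valid_def)

text \<open>Least rank is now taken among points with a label up to \<open>k\<close>. By minimality
  the points seen from there with such labels stay in the cluster, while label \<open>Suc k\<close>
  occurs strictly above; so the cluster is not final and has \<open>Suc k\<close> distinct
  points.\<close>

lemma frame_valid_gam_bar:
  fixes rk :: "'w \<Rightarrow> nat"
  assumes pre: "preorder_on W R"
    and rk: "\<And>x y. x \<in> W \<Longrightarrow> y \<in> W \<Longrightarrow> (x, y) \<in> R \<Longrightarrow> (y, x) \<notin> R \<Longrightarrow> rk y < rk x"
    and size: "\<And>x. x \<in> W \<Longrightarrow> \<not> final W R x \<Longrightarrow> size_le n (cluster W R x)"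
  shows "frame_valid W R (gam_bar n)"
proof (cases n)
  case (enat k)
  let ?Q = "\<lambda>i j. i < Suc k \<or> i = Suc k \<and> j = Suc k"
  have "sat W R V x (frame_form (Suc (Suc k)) ?Q)" if x: "x \<in> W" for V x
  proof (rule ccontr)
    assume "\<not> ?thesis"
    then have x0: "x \<in> V 0"
      and disj: "\<And>i j y. i < Suc (Suc k) \<Longrightarrow> j < Suc (Suc k) \<Longrightarrow> i \<noteq> j \<Longrightarrow> y \<in> W \<Longrightarrow> (x, y) \<in> R \<Longrightarrow>
          y \<in> V i \<Longrightarrow> y \<notin> V j"
      and see: "\<And>i j y. i < Suc (Suc k) \<Longrightarrow> j < Suc (Suc k) \<Longrightarrow> ?Q i j \<Longrightarrow> y \<in> W \<Longrightarrow> (x, y) \<in> R \<Longrightarrow>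
          y \<in> V i \<Longrightarrow> \<exists>z\<in>W. (y, z) \<in> R \<and> z \<in> V j"
      and nsee: "\<And>i j y z. i < Suc (Suc k) \<Longrightarrow> j < Suc (Suc k) \<Longrightarrow> \<not> ?Q i j \<Longrightarrow> y \<in> W \<Longrightarrow>
          (x, y) \<in> R \<Longrightarrow> y \<in> V i \<Longrightarrow> z \<in> W \<Longrightarrow> (y, z) \<in> R \<Longrightarrow> z \<notin> V j"
      unfolding sat_frame_form not_not by meson+
    let ?P = "\<lambda>y. y \<in> W \<and> (x, y) \<in> R \<and> (\<exists>i<Suc k. y \<in> V i)"
    have "?P x"
      using x x0 preorder_on_refl[OF pre x] by blast
    then obtain y where "?P y" and min: "\<And>z. ?P z \<Longrightarrow> \<not> rk z < rk y"
      using minimal_rank[of ?P x rk] by blast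
    then obtain j where y: "y \<in> W" "(x, y) \<in> R" and j: "j < Suc k" "y \<in> V j"
      by blast
    have "\<exists>z\<in>W. (y, z) \<in> R \<and> z \<in> V i" if "i < Suc (Suc k)" for i
      using see[of j i y] that y j by auto
    then obtain z where z: "\<And>i. i < Suc (Suc k) \<Longrightarrow> z i \<in> W \<and> (y, z i) \<in> R \<and> z i \<in> V i"
      by metis
    have xz: "(x, z i) \<in> R" if "i < Suc (Suc k)" for i
      using z[OF that] preorder_on_trans[OF pre y(2)] by blast
    have bk: "(z i, y) \<in> R" if "i < Suc k" for i
      using z[of i] xz[of i] that min[of "z i"] rk[of y "z i"] y by auto
    \<comment> \<open>A return would let a point labelled \<open>Suc k\<close> see one labelled
      0.\<close>
    have "(z (Suc k), y) \<notin> R"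
    proof
      assume "(z (Suc k), y) \<in> R"
      then have "(z (Suc k), z 0) \<in> R"
        using z[of 0] preorder_on_trans[OF pre] by blast
      then show False
        using nsee[of "Suc k" 0 "z (Suc k)" "z 0"] z[of "Suc k"] z[of 0] xz[of "Suc k"] by auto
    qed
    then have nf: "\<not> final W R y"
      using z[of "Suc k"] by (auto simp: final_def)
    show False
    proof (rule size_le_inj)
      show "size_le (enat k) (cluster W R y)"
        using size[OF y(1) nf] enat by simp
      show "z i \<in> cluster W R y" if "i < Suc k" for i
        using z[of i] bk[of i] that by (auto simp: cluster_def)
      show "inj_on z {..<Suc k}"
        using z disj xz unfolding inj_on_def by (metis lessThan_iff less_SucI)
    qed
  qed
  then show ?thesis
    by (simp add: enat gam_bar_def topped_cluster_form_def frame_valid_def)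
qed (simp add: gam_bar_def frame_valid_def)


section \<open>Derivability and maximal consistent sets\<close>

text \<open>Necessitation is available only inside \<open>L\<close> and never for hypotheses, so
  that the deduction theorem holds.\<close>

inductive ded :: "form set \<Rightarrow> form set \<Rightarrow> form \<Rightarrow> bool" for L A where
  ax: "\<phi> \<in> L \<Longrightarrow> ded L A \<phi>"
| hyp: "\<phi> \<in> A \<Longrightarrow> ded L A \<phi>"
| mp: "ded L A \<phi> \<Longrightarrow> ded L A (Imp \<phi> \<psi>) \<Longrightarrow> ded L A \<psi>"

lemma ded_mono: "ded L A \<phi> \<Longrightarrow> A \<subseteq> B \<Longrightarrow> ded L B \<phi>"
  by (induction rule: ded.induct) (auto intro: ded.intros)

lemma ded_Union_chain:
  assumes "ded L (\<Union>C) \<phi>" "C \<noteq> {}" "\<And>A B. A \<in> C \<Longrightarrow> B \<in> C \<Longrightarrow> A \<subseteq> B \<or> B \<subseteq> A"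
  shows "\<exists>A\<in>C. ded L A \<phi>"
  using assms(1)
proof (induction rule: ded.induct)
  case (mp \<phi> \<psi>)
  then obtain A B where "A \<in> C" "B \<in> C" "ded L A \<phi>" "ded L B (Imp \<phi> \<psi>)" by blast
  then show ?case
    using assms(3)[of A B] by (meson ded.mp ded_mono)
qed (use assms(2) in \<open>auto intro: ded.intros\<close>)

definition unbox :: "form set \<Rightarrow> form set" where
  "unbox s = {\<phi>. Box \<phi> \<in> s}"

locale s4_logic =
  fixes L :: "form set"
  assumes normal: "normal_logic L" and S4_sub: "S4 \<subseteq> L"
begin

abbreviation der :: "form set \<Rightarrow> form \<Rightarrow> bool" (infix "\<turnstile>" 50) where
  "A \<turnstile> \<phi> \<equiv> ded L A \<phi>"

lemma taut: "(\<And>v. tval v \<phi>) \<Longrightarrow> \<phi> \<in> L"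
  using normal unfolding normal_logic_def tautology_def by blast

lemma L_mp: "Imp \<phi> \<psi> \<in> L \<Longrightarrow> \<phi> \<in> L \<Longrightarrow> \<psi> \<in> L"
  using normal by (rule normal_logic_mp)

lemma nec: "\<phi> \<in> L \<Longrightarrow> Box \<phi> \<in> L"
  using normal unfolding normal_logic_def by blast

lemma K_ax: "Imp (Box (Imp \<phi> \<psi>)) (Imp (Box \<phi>) (Box \<psi>)) \<in> L"
  using normal unfolding normal_logic_def by blast

lemma T_ax: "Imp (Box \<phi>) \<phi> \<in> L" and four_ax: "Imp (Box \<phi>) (Box (Box \<phi>)) \<in> L"
proof -
  have "Imp (Box \<phi>) \<phi> \<in> S4" "Imp (Box \<phi>) (Box (Box \<phi>)) \<in> S4"
    by (rule S4_I, simp, meson preorder_on_refl preorder_on_trans)+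
  then show "Imp (Box \<phi>) \<phi> \<in> L" "Imp (Box \<phi>) (Box (Box \<phi>)) \<in> L"
    using S4_sub by blast+
qed

lemma der_taut: "(\<And>v. tval v \<phi>) \<Longrightarrow> A \<turnstile> \<phi>"
  by (rule ded.ax[OF taut])

lemma der_taut1: "A \<turnstile> \<phi> \<Longrightarrow> (\<And>v. tval v \<phi> \<Longrightarrow> tval v \<psi>) \<Longrightarrow> A \<turnstile> \<psi>"
  by (rule ded.mp[OF _ der_taut]) auto

lemma der_taut2:
  "A \<turnstile> \<phi> \<Longrightarrow> A \<turnstile> \<psi> \<Longrightarrow> (\<And>v. tval v \<phi> \<Longrightarrow> tval v \<psi> \<Longrightarrow> tval v \<xi>) \<Longrightarrow> A \<turnstile> \<xi>"
  by (rule ded.mp[OF _ ded.mp[OF _ der_taut[of "Imp \<phi> (Imp \<psi> \<xi>)"]]]) auto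

lemma deduction: "insert \<alpha> A \<turnstile> \<phi> \<Longrightarrow> A \<turnstile> Imp \<alpha> \<phi>"
proof (induction rule: ded.induct)
  case (ax \<phi>)
  show ?case
    by (rule der_taut1[OF ded.ax[OF ax]]) simp
next
  case (hyp \<phi>)
  have "A \<turnstile> Imp \<alpha> \<phi>" if "\<phi> \<in> A"
    by (rule der_taut1[OF ded.hyp[OF that]]) simp
  moreover have "A \<turnstile> Imp \<alpha> \<alpha>"
    by (rule der_taut) simp
  ultimately show ?case
    using hyp by blast
next
  case (mp \<phi> \<psi>)
  show ?case
    by (rule der_taut2[OF mp.IH]) auto
qed

lemma der_empty: "{} \<turnstile> \<phi> \<Longrightarrow> \<phi> \<in> L"
  by (induction rule: ded.induct) (auto intro: L_mp)

text \<open>Compactness in the form used for separation: finitely many hypotheses from \<open>T\<close> are merged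
  into one.\<close>

lemma der_Un_conj:
  assumes "A \<union> T \<turnstile> \<theta>" "Top \<in> T" "\<And>\<chi> \<chi>'. \<chi> \<in> T \<Longrightarrow> \<chi>' \<in> T \<Longrightarrow> And \<chi> \<chi>' \<in> T"
  shows "\<exists>\<chi>\<in>T. A \<turnstile> Imp \<chi> \<theta>"
  using assms(1)
proof (induction rule: ded.induct)
  case (ax \<phi>)
  have "A \<turnstile> Imp Top \<phi>"
    by (rule der_taut1[OF ded.ax[OF ax]]) simp
  then show ?case using assms(2) by blast
next
  case (hyp \<phi>)
  have "A \<turnstile> Imp Top \<phi>" if "\<phi> \<in> A"
    by (rule der_taut1[OF ded.hyp[OF that]]) simp
  moreover have "A \<turnstile> Imp \<phi> \<phi>"
    by (rule der_taut) simp
  ultimately show ?case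
    using hyp assms(2) by blast
next
  case (mp \<phi> \<psi>)
  then obtain a b where "a \<in> T" "b \<in> T" and ab: "A \<turnstile> Imp a \<phi>" "A \<turnstile> Imp b (Imp \<phi> \<psi>)"
    by blast
  moreover from ab have "A \<turnstile> Imp (And a b) \<psi>"
    by (rule der_taut2) auto
  ultimately show ?case
    using assms(3) by blast
qed

section \<open>Maximal consistent sets\<close>

definition mcs :: "form set \<Rightarrow> bool" where
  "mcs s \<longleftrightarrow> \<not> s \<turnstile> Bot \<and> (\<forall>\<phi>. \<phi> \<in> s \<or> Neg \<phi> \<in> s)"

lemma lindenbaum:
  assumes "\<not> A \<turnstile> Bot"
  obtains s where "mcs s" "A \<subseteq> s"
proof -
  let ?X = "{B. A \<subseteq> B \<and> \<not> B \<turnstile> Bot}"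
  have "\<exists>M\<in>?X. \<forall>X\<in>?X. M \<subseteq> X \<longrightarrow> X = M"
  proof (rule subset_Zorn)
    fix C assume C: "subset.chain ?X C"
    show "\<exists>U\<in>?X. \<forall>X\<in>C. X \<subseteq> U"
    proof (cases "C = {}")
      case False
      then have "\<not> \<Union>C \<turnstile> Bot"
        using C ded_Union_chain[of L C Bot] unfolding subset.chain_def subset_chain_def by blast
      moreover have "A \<subseteq> \<Union>C"
        using C False unfolding subset.chain_def by blast
      ultimately show ?thesis by blast
    qed (use assms in auto)
  qed
  then obtain M where M: "A \<subseteq> M" "\<not> M \<turnstile> Bot" and max: "\<And>X. M \<subseteq> X \<Longrightarrow> \<not> X \<turnstile> Bot \<Longrightarrow> X = M"
    by (smt (verit) mem_Collect_eq subset_trans)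
  have "\<phi> \<in> M \<or> Neg \<phi> \<in> M" for \<phi>
  proof (rule ccontr)
    assume *: "\<not> ?thesis"
    then have "insert \<phi> M \<turnstile> Bot" "insert (Neg \<phi>) M \<turnstile> Bot"
      using max[of "insert \<phi> M"] max[of "insert (Neg \<phi>) M"] by blast+
    from der_taut2[OF this[THEN deduction], of Bot] have "M \<turnstile> Bot"
      by auto
    with M show False by blast
  qed
  with M that show thesis
    by (auto simp: mcs_def)
qed

lemma mcs_der:
  assumes "mcs s"
  shows "s \<turnstile> \<phi> \<longleftrightarrow> \<phi> \<in> s"
proof
  assume "s \<turnstile> \<phi>"
  then have "\<not> s \<turnstile> Neg \<phi>"
    using assms der_taut2[of s \<phi> "Neg \<phi>" Bot] unfolding mcs_def by auto
  then show "\<phi> \<in> s"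
    using assms unfolding mcs_def by (blast intro: ded.hyp)
qed (rule ded.hyp)

lemma mcs_L: "mcs s \<Longrightarrow> \<phi> \<in> L \<Longrightarrow> \<phi> \<in> s"
  using mcs_der ded.ax by blast

lemma mcs_mp: "mcs s \<Longrightarrow> Imp \<phi> \<psi> \<in> L \<Longrightarrow> \<phi> \<in> s \<Longrightarrow> \<psi> \<in> s"
  using mcs_der ded.mp ded.hyp ded.ax by metis

lemma mcs_Top [simp]: "mcs s \<Longrightarrow> Top \<in> s"
  by (rule mcs_L) (simp_all add: taut)

lemma mcs_Bot [simp]: "mcs s \<Longrightarrow> Bot \<notin> s"
  using mcs_der[of s Bot] by (simp add: mcs_def)

lemma mcs_Neg [simp]:
  assumes s: "mcs s"
  shows "Neg \<phi> \<in> s \<longleftrightarrow> \<phi> \<notin> s"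
proof -
  have "\<not> (\<phi> \<in> s \<and> Neg \<phi> \<in> s)"
    using der_taut2[of s \<phi> "Neg \<phi>" Bot] mcs_der[OF s] mcs_Bot[OF s] by auto
  then show ?thesis
    using s unfolding mcs_def by blast
qed

lemma mcs_And [simp]:
  assumes s: "mcs s"
  shows "And \<phi> \<psi> \<in> s \<longleftrightarrow> \<phi> \<in> s \<and> \<psi> \<in> s"
proof -
  have "Imp (And \<phi> \<psi>) \<phi> \<in> L" "Imp (And \<phi> \<psi>) \<psi> \<in> L"
    by (rule taut, simp)+
  moreover have "And \<phi> \<psi> \<in> s" if "\<phi> \<in> s" "\<psi> \<in> s"
    using der_taut2[of s \<phi> \<psi> "And \<phi> \<psi>"] that mcs_der[OF s] by simp
  ultimately show ?thesis
    using mcs_mp[OF s] by blast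
qed

lemma mcs_Or [simp]:
  assumes s: "mcs s"
  shows "Or \<phi> \<psi> \<in> s \<longleftrightarrow> \<phi> \<in> s \<or> \<psi> \<in> s"
proof -
  have "Imp (Or \<phi> \<psi>) (Neg (And (Neg \<phi>) (Neg \<psi>))) \<in> L"
    "Imp (Neg (And (Neg \<phi>) (Neg \<psi>))) (Or \<phi> \<psi>) \<in> L"
    by (rule taut, simp, blast?)+
  from mcs_mp[OF s this(1)] mcs_mp[OF s this(2)] s show ?thesis by auto
qed

text \<open>Necessitation boxes the axioms used, and K carries the box across modus ponens.\<close>

lemma der_Box: "A \<turnstile> \<phi> \<Longrightarrow> Box ` A \<turnstile> Box \<phi>"
proof (induction rule: ded.induct)
  case (mp \<phi> \<psi>)
  show ?case
    by (rule ded.mp[OF mp.IH(1) ded.mp[OF mp.IH(2) ded.ax[OF K_ax]]])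
next
  case (ax \<phi>)
  show ?case
    by (rule ded.ax[OF nec[OF ax]])
next
  case (hyp \<phi>)
  show ?case
    by (rule ded.hyp) (simp add: hyp)
qed

lemma mcs_unbox:
  assumes s: "mcs s"
  shows "unbox s \<turnstile> \<phi> \<longleftrightarrow> \<phi> \<in> unbox s"
proof
  assume "unbox s \<turnstile> \<phi>"
  then have "Box ` unbox s \<turnstile> Box \<phi>"
    by (rule der_Box)
  moreover have "Box ` unbox s \<subseteq> s"
    by (auto simp: unbox_def)
  ultimately have "s \<turnstile> Box \<phi>"
    by (rule ded_mono)
  then show "\<phi> \<in> unbox s"
    using s by (simp add: mcs_der unbox_def)
qed (rule ded.hyp)

lemma unbox_And:
  assumes "mcs s" "\<phi> \<in> unbox s" "\<psi> \<in> unbox s"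
  shows "And \<phi> \<psi> \<in> unbox s"
  using der_taut2[of "unbox s" \<phi> \<psi> "And \<phi> \<psi>"] assms by (simp add: mcs_unbox)

lemma unbox_Top: "mcs s \<Longrightarrow> Top \<in> unbox s"
  using der_taut[of Top "unbox s"] by (simp add: mcs_unbox)

lemma mcs_eq: "mcs s \<Longrightarrow> mcs u \<Longrightarrow> s \<subseteq> u \<Longrightarrow> s = u"
  using mcs_Neg by blast

section \<open>The canonical model\<close>

abbreviation M :: "form set set" where
  "M \<equiv> {s. mcs s}"

definition cR :: "form set rel" where
  "cR = {(s, u). mcs s \<and> mcs u \<and> unbox s \<subseteq> u}"

lemma unbox_sub: "mcs s \<Longrightarrow> unbox s \<subseteq> s"
  using mcs_mp[OF _ T_ax] by (auto simp: unbox_def)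

text \<open>Axiom 4 turns \<open>cR\<close> into inclusion of the sets \<open>unbox s\<close>; the
  Zorn argument in \<open>pmax_exists\<close> relies on this form.\<close>

lemma cR_unbox: "(s, u) \<in> cR \<longleftrightarrow> mcs s \<and> mcs u \<and> unbox s \<subseteq> unbox u"
proof -
  have "unbox s \<subseteq> unbox u" if "mcs s" "unbox s \<subseteq> u"
    using that mcs_mp[OF _ four_ax] by (auto simp: unbox_def)
  then show ?thesis
    using unbox_sub by (auto simp: cR_def)
qed

lemma preorder_cR: "preorder_on M cR"
  unfolding preorder_on_def refl_on_def trans_def cR_unbox by (auto simp: cR_def)

lemma cR_trans: "(s, u) \<in> cR \<Longrightarrow> (u, v) \<in> cR \<Longrightarrow> (s, v) \<in> cR"
  using preorder_on_trans[OF preorder_cR] .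

lemma cR_witness:
  assumes "mcs s" "Box \<phi> \<notin> s"
  obtains u where "(s, u) \<in> cR" "\<phi> \<notin> u"
proof -
  have "\<not> insert (Neg \<phi>) (unbox s) \<turnstile> Bot"
  proof
    assume "insert (Neg \<phi>) (unbox s) \<turnstile> Bot"
    then have "unbox s \<turnstile> \<phi>"
      by (rule der_taut1[OF deduction]) auto
    then show False
      using assms by (simp add: mcs_unbox) (simp add: unbox_def)
  qed
  then obtain u where "mcs u" "insert (Neg \<phi>) (unbox s) \<subseteq> u"
    using lindenbaum by blast
  then show thesis
    using that assms by (auto simp: cR_def)
qed

text \<open>Interpreting atoms through a substitution makes every definable labelling of the
  canonical frame available; as \<open>L\<close> is closed under substitution, its frame formulas
  hold under each of them.\<close>

lemma canonical_truth:
  "mcs s \<Longrightarrow> sat M cR (\<lambda>p. {s. \<tau> p \<in> s}) s \<phi> \<longleftrightarrow> subst \<tau> \<phi> \<in> s"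
proof (induction \<phi> arbitrary: s)
  case (Box \<phi>)
  have "Box \<psi> \<in> s \<longleftrightarrow> (\<forall>u. (s, u) \<in> cR \<longrightarrow> \<psi> \<in> u)" for \<psi>
    using cR_witness[OF Box.prems, of \<psi>] by (auto simp: cR_def unbox_def)
  then show ?case
    using Box by (auto simp: cR_def)
qed auto

lemma canonical_sat: "\<phi> \<in> L \<Longrightarrow> mcs s \<Longrightarrow> sat M cR (\<lambda>p. {s. \<tau> p \<in> s}) s \<phi>"
  using canonical_truth normal_logic_subst[OF normal] mcs_L by blast

lemma confluent_cR:
  assumes "dot2 \<in> L"
  shows "confluent M cR"
proof -
  have "\<exists>w. (u, w) \<in> cR \<and> (v, w) \<in> cR" if "(s, u) \<in> cR" "(s, v) \<in> cR" for s u v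
  proof -
    have mcs: "mcs s" "mcs u" "mcs v"
      using that by (auto simp: cR_def)
    have "\<not> unbox u \<union> unbox v \<turnstile> Bot"
    proof
      assume "unbox u \<union> unbox v \<turnstile> Bot"
      \<comment> \<open>Compactness yields one \<open>\<chi>\<close> that is boxed in
        \<open>v\<close> and fails everywhere above \<open>u\<close>; interpreting the atom of
        \<open>dot2\<close> by it contradicts \<open>dot2\<close> at \<open>s\<close>.\<close>
      from der_Un_conj[OF this unbox_Top[OF mcs(3)] unbox_And[OF mcs(3)]]
      obtain \<chi> where \<chi>: "\<chi> \<in> unbox v" "unbox u \<turnstile> Imp \<chi> Bot"
        by blast
      have "unbox u \<turnstile> Neg \<chi>"
        using \<chi>(2) by (rule der_taut1) auto
      then have "Neg \<chi> \<in> unbox u"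
        using mcs by (simp add: mcs_unbox)
      then have "\<forall>x\<in>M. (u, x) \<in> cR \<longrightarrow> \<chi> \<notin> x"
        using mcs_Neg by (auto simp: cR_def)
      moreover have "\<forall>x\<in>M. (v, x) \<in> cR \<longrightarrow> \<chi> \<in> x"
        using \<chi>(1) by (auto simp: cR_def)
      moreover have "sat M cR (\<lambda>p. {s. \<chi> \<in> s}) s dot2"
        using canonical_sat[OF assms mcs(1)] .
      ultimately show False
        using that mcs by (simp add: dot2_def) metis
    qed
    then obtain w where "mcs w" "unbox u \<union> unbox v \<subseteq> w"
      using lindenbaum by blast
    then show ?thesis
      using mcs by (auto simp: cR_def)
  qed
  moreover have "w \<in> M" if "(u, w) \<in> cR" for u w
    using that by (simp add: cR_def)
  ultimately show ?thesis
    unfolding confluent_def by metis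
qed

section \<open>Bounds on clusters of the canonical model\<close>

lemma separating_formula:
  assumes "finite F" "\<And>u. u \<in> F \<Longrightarrow> mcs u" "mcs s" "s \<notin> F"
  shows "\<exists>\<delta>. \<delta> \<in> s \<and> (\<forall>u\<in>F. \<delta> \<notin> u)"
  using assms
proof (induction F rule: finite_induct)
  case empty
  then show ?case using mcs_Top by blast
next
  case (insert u F)
  then obtain \<delta> where \<delta>: "\<delta> \<in> s" "\<forall>u\<in>F. \<delta> \<notin> u" by auto
  obtain \<epsilon> where "\<epsilon> \<in> s" "\<epsilon> \<notin> u"
    using insert.prems mcs_eq[of s u] by blast
  then show ?case
    using \<delta> insert.prems by (intro exI[of _ "And \<delta> \<epsilon>"]) auto
qed

text \<open>The induction splits off the new point by a formula \<open>\<delta>\<close> separating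
  it from the old ones and restricts the old formulas to the complement of
  \<open>\<delta>\<close>.\<close>

lemma partition_formulas:
  assumes "\<And>i. i < Suc k \<Longrightarrow> mcs (z i)" "inj_on z {..<Suc k}"
  shows "\<exists>\<sigma>. (\<forall>i<Suc k. \<sigma> i \<in> z i) \<and> (\<forall>u. mcs u \<longrightarrow> (\<exists>!i. i < Suc k \<and> \<sigma> i \<in> u))"
  using assms
proof (induction k)
  case 0
  then show ?case
    by (intro exI[of _ "\<lambda>_. Top"]) auto
next
  case (Suc k)
  have "inj_on z {..<Suc k}"
    using Suc.prems(2) by (rule inj_on_subset) auto
  with Suc obtain \<sigma> where \<sigma>: "\<And>i. i < Suc k \<Longrightarrow> \<sigma> i \<in> z i"
      "\<And>u. mcs u \<Longrightarrow> \<exists>!i. i < Suc k \<and> \<sigma> i \<in> u"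
    by (metis less_SucI)
  have "z (Suc k) \<notin> z ` {..<Suc k}"
    using inj_on_image_mem_iff[OF Suc.prems(2), of "Suc k" "{..<Suc k}"] by auto
  moreover have "u \<in> z ` {..<Suc k} \<Longrightarrow> mcs u" for u
    using Suc.prems(1) by auto
  ultimately obtain \<delta> where \<delta>: "\<delta> \<in> z (Suc k)" "\<And>i. i < Suc k \<Longrightarrow> \<delta> \<notin> z i"
    using separating_formula[of "z ` {..<Suc k}" "z (Suc k)"] Suc.prems(1)[of "Suc k"] by auto
  define \<tau> where "\<tau> i = (if i < Suc k then And (\<sigma> i) (Neg \<delta>) else \<delta>)" for i
  have "\<tau> i \<in> z i" if "i < Suc (Suc k)" for i
    using that \<sigma>(1)[of i] \<delta> Suc.prems(1)[of i] by (cases "i = Suc k") (auto simp: \<tau>_def)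
  moreover have "\<exists>!i. i < Suc (Suc k) \<and> \<tau> i \<in> u" if u: "mcs u" for u
  proof (cases "\<delta> \<in> u")
    case True
    then show ?thesis
      using u by (intro ex1I[of _ "Suc k"]) (auto simp: \<tau>_def split: if_splits)
  next
    case False
    obtain i where i: "i < Suc k" "\<sigma> i \<in> u" and uniq: "\<And>j. j < Suc k \<Longrightarrow> \<sigma> j \<in> u \<Longrightarrow> j = i"
      using \<sigma>(2)[OF u] by blast
    show ?thesis
    proof (rule ex1I[of _ i])
      show "i < Suc (Suc k) \<and> \<tau> i \<in> u"
        using False u i by (simp add: \<tau>_def)
      fix j assume "j < Suc (Suc k) \<and> \<tau> j \<in> u"
      then have "j < Suc k" "\<sigma> j \<in> u"
        using False u by (auto simp: \<tau>_def split: if_splits)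
      then show "j = i" by (rule uniq)
    qed
  qed
  ultimately show ?case by blast
qed

text \<open>With too many points in the cluster, formulas partitioning them would refute an instance
  of the matching frame formula at one of them. In the non-final case maximality of \<open>s\<close>
  for \<open>a\<close> makes the cluster definable above \<open>s\<close>.\<close>

lemma cluster_bound:
  assumes s: "mcs s" "a \<in> s"
    and max: "\<And>u. (s, u) \<in> cR \<Longrightarrow> a \<in> u \<Longrightarrow> (u, s) \<in> cR"
    and gam: "gam m \<in> L" "gam_bar n \<in> L"
  shows "size_le (if final M cR s then m else n) (cluster M cR s)"
proof (rule ccontr)
  assume not: "\<not> ?thesis"
  then obtain k where k: "(if final M cR s then m else n) = enat k"
    using size_le_infinity by (metis enat.exhaust)
  with not have "\<not> size_le (enat k) (cluster M cR s)"
    by simp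
  then obtain z where "\<And>i. i < Suc k \<Longrightarrow> z i \<in> cluster M cR s" "inj_on z {..<Suc k}"
    by (rule not_size_le_inj) blast
  then have zR: "\<And>i. i < Suc k \<Longrightarrow> (s, z i) \<in> cR \<and> (z i, s) \<in> cR" and z: "\<And>i. i < Suc k \<Longrightarrow> mcs (z i)"
    and inj: "inj_on z {..<Suc k}"
    by (auto simp: cluster_def)
  from partition_formulas[of k z, OF z inj]
  obtain \<sigma> where \<sigma>: "\<And>i. i < Suc k \<Longrightarrow> \<sigma> i \<in> z i"
      and part: "\<And>u. mcs u \<Longrightarrow> \<exists>!i. i < Suc k \<and> \<sigma> i \<in> u"
    by metis
  have ref: "(u, u) \<in> cR" if "mcs u" for u
    using preorder_on_refl[OF preorder_cR] that by auto
  have z0: "mcs (z 0)" "(s, z 0) \<in> cR" "(z 0, s) \<in> cR" "\<sigma> 0 \<in> z 0"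
    using z[of 0] zR[of 0] \<sigma>[of 0] by simp_all
  show False
  proof (cases "final M cR s")
    case True
    \<comment> \<open>Every point above a final cluster belongs to it, hence sees each
      \<open>z j\<close>.\<close>
    have bk: "(u, z j) \<in> cR" if "(z 0, u) \<in> cR" "j < Suc k" for u j
    proof -
      have "(s, u) \<in> cR" "u \<in> M"
        using cR_trans[OF z0(2) that(1)] by (auto simp: cR_def)
      then have "(u, s) \<in> cR"
        using True by (simp add: final_def)
      then show ?thesis
        using zR[OF that(2)] cR_trans by blast
    qed
    have "sat M cR (\<lambda>p. {s. \<sigma> p \<in> s}) (z 0) (frame_form (Suc k) (\<lambda>i j. True))"
      using canonical_sat[OF gam(1) z0(1)] True k by (simp add: gam_def cluster_form_def)
    then show False
      unfolding sat_frame_form using z0(4) part bk \<sigma> z by (smt (verit) mem_Collect_eq)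
  next
    case False
    then obtain t where t: "(s, t) \<in> cR" "(t, s) \<notin> cR"
      by (auto simp: final_def)
    \<comment> \<open>Above \<open>s\<close>, \<open>Dia a\<close> holds exactly on the cluster, by
      maximality. Labels up to \<open>k\<close> partition the cluster, and the extra label
      \<open>Suc k\<close> takes everything strictly above it.\<close>
    define \<tau> where "\<tau> i = (if i < Suc k then And (\<sigma> i) (Dia a) else Neg (Dia a))" for i
    have Dia: "Dia a \<in> u \<longleftrightarrow> (u, s) \<in> cR" if u: "(s, u) \<in> cR" for u
    proof
      have mu: "mcs u" using u by (auto simp: cR_def)
      show "(u, s) \<in> cR" if "Dia a \<in> u"
      proof -
        have "Box (Neg a) \<notin> u"
          using that mu by simp
        then obtain w where w: "(u, w) \<in> cR" "Neg a \<notin> w"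
          by (rule cR_witness[OF mu])
        then have "a \<in> w" by (auto simp: cR_def)
        then show ?thesis
          using max[of w] w(1) u cR_trans by blast
      qed
      show "Dia a \<in> u" if "(u, s) \<in> cR"
        using that s mu by (auto simp: cR_def unbox_def)
    qed
    have z0u: "(s, u) \<in> cR" if "(z 0, u) \<in> cR" for u
      using that z0 cR_trans by blast
    have \<tau>: "\<tau> i \<in> u \<longleftrightarrow> (if i < Suc k then \<sigma> i \<in> u \<and> (u, s) \<in> cR else (u, s) \<notin> cR)"
      if "(z 0, u) \<in> cR" for i u
    proof -
      have "mcs u" using that by (auto simp: cR_def)
      then show ?thesis
        using Dia[OF z0u[OF that]] by (auto simp: \<tau>_def)
    qed
    let ?Q = "\<lambda>i j. i < Suc k \<or> i = Suc k \<and> j = Suc k"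
    \<comment> \<open>The facts \<open>c1\<close> to \<open>c5\<close> are the five conjuncts of a
      refutation as listed in \<open>sat_frame_form\<close>.\<close>
    have c1: "z 0 \<in> {s. \<tau> 0 \<in> s}"
      using \<tau>[OF ref[OF z0(1)]] z0 by simp
    have c2: "\<exists>i<Suc (Suc k). y \<in> {s. \<tau> i \<in> s}" if "y \<in> M" "(z 0, y) \<in> cR" for y
      using \<tau>[OF that(2)] part[of y] that(1) by (metis less_SucI lessI less_irrefl mem_Collect_eq)
    have c3: "y \<notin> {s. \<tau> j \<in> s}"
      if ij: "i < Suc (Suc k)" "j < Suc (Suc k)" "i \<noteq> j"
        and y: "y \<in> M" "(z 0, y) \<in> cR" "y \<in> {s. \<tau> i \<in> s}" for i j y
    proof
      assume "y \<in> {s. \<tau> j \<in> s}"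
      then have \<tau>y: "\<tau> i \<in> y" "\<tau> j \<in> y" using y(3) by auto
      have uniq: "\<exists>!i. i < Suc k \<and> \<sigma> i \<in> y"
        using part y(1) by simp
      consider "i < Suc k" "j < Suc k" | "i < Suc k" "j = Suc k" | "i = Suc k" "j < Suc k"
        using ij less_Suc_eq by blast
      then show False
      proof cases
        case 1
        then have "\<sigma> i \<in> y" "\<sigma> j \<in> y"
          using \<tau>y \<tau>[OF y(2)] by simp_all
        then show False
          using uniq 1 ij(3) by blast
      qed (use \<tau>y \<tau>[OF y(2)] in simp_all)
    qed
    have c4: "\<exists>x\<in>M. (y, x) \<in> cR \<and> x \<in> {s. \<tau> j \<in> s}"
      if ij: "i < Suc (Suc k)" "j < Suc (Suc k)" "?Q i j"
        and y: "y \<in> M" "(z 0, y) \<in> cR" "y \<in> {s. \<tau> i \<in> s}" for i j y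
    proof (cases "i = Suc k")
      case True
      then show ?thesis using ij y ref by auto
    next
      case False
      then have ys: "(y, s) \<in> cR"
        using \<tau>[OF y(2)] ij y(3) by (auto split: if_splits)
      \<comment> \<open>From within the cluster each \<open>z j\<close> is visible, and the strict
        successor \<open>t\<close> carries the last label.\<close>
      let ?x = "if j < Suc k then z j else t"
      have "(y, ?x) \<in> cR"
        using ys zR t cR_trans by auto
      moreover have "\<tau> j \<in> ?x"
        using \<tau>[of ?x j] calculation y(2) cR_trans[of "z 0" y ?x] \<sigma>[of j] zR[of j] t by auto
      moreover have "?x \<in> M"
        using calculation(1) by (auto simp: cR_def)
      ultimately show ?thesis by blast
    qed
    have c5: "x \<notin> {s. \<tau> j \<in> s}"
      if ij: "i < Suc (Suc k)" "j < Suc (Suc k)" "\<not> ?Q i j"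
        and y: "y \<in> M" "(z 0, y) \<in> cR" "y \<in> {s. \<tau> i \<in> s}" and x: "x \<in> M" "(y, x) \<in> cR" for i j y x
    proof -
      have "i = Suc k" "j < Suc k" using ij by auto
      moreover from this have "(y, s) \<notin> cR"
        using \<tau>[OF y(2), of i] y(3) by simp
      ultimately show ?thesis
        using \<tau>[of x j] cR_trans[OF y(2) x(2)] cR_trans[OF x(2)] by auto
    qed
    have "\<not> sat M cR (\<lambda>p. {s. \<tau> p \<in> s}) (z 0) (frame_form (Suc (Suc k)) ?Q)"
      unfolding sat_frame_form not_not
      by (intro conjI allI ballI impI; rule c1 c2 c3 c4 c5; assumption)
    moreover have "sat M cR (\<lambda>p. {s. \<tau> p \<in> s}) (z 0) (frame_form (Suc (Suc k)) ?Q)"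
      using canonical_sat[OF gam(2) z0(1)] False k by (simp add: gam_bar_def topped_cluster_form_def)
    ultimately show False
      by blast
  qed
qed

end


section \<open>Amalgamation of canonical models\<close>

lemma size_le_1D:
  assumes "size_le 1 A" "x \<in> A" "y \<in> A"
  shows "x = y"
proof (rule ccontr)
  assume "x \<noteq> y"
  then show False
    using size_leD[OF assms(1), of "{x, y}"] assms(2,3) by (auto simp: one_enat_def)
qed

lemma size_le_2D:
  assumes "size_le 2 A" "x \<in> A" "y \<in> A" "z \<in> A" "x \<noteq> y"
  shows "z \<in> {x, y}"
proof (rule ccontr)
  assume "z \<notin> {x, y}"
  then show False
    using size_leD[OF assms(1), of "{x, y, z}"] assms(2-5) by (auto simp: numeral_eq_enat)
qed

text \<open>Bound \<open>2\<close> is what makes amalgamation work: a rectangular relation between two sets of at most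
  two elements that is total and onto contains a total and onto subrelation with at most two pairs.
  This fails for three elements.\<close>

lemma rectangular_selection:
  assumes x0: "x0 \<in> D"
    and rect: "\<And>a b c d. (a, b) \<in> D \<Longrightarrow> (c, b) \<in> D \<Longrightarrow> (c, d) \<in> D \<Longrightarrow> (a, d) \<in> D"
    and k: "k \<in> {1, 2, \<infinity>}"
    and size: "T1 \<Longrightarrow> size_le k (fst ` D)" "T2 \<Longrightarrow> size_le k (snd ` D)"
  shows "\<exists>S\<subseteq>D. x0 \<in> S \<and> (T1 \<longrightarrow> fst ` S = fst ` D) \<and> (T2 \<longrightarrow> snd ` S = snd ` D) \<and> size_le k S"
proof -
  obtain a0 b0 where ab: "x0 = (a0, b0)" by (cases x0)
  have D0: "(a0, b0) \<in> D" using x0 ab by simp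
  have inD: "a \<in> fst ` D" "b \<in> snd ` D" if "(a, b) \<in> D" for a b
    using that by force+
  consider "k = 1" | "k = 2" | "k = \<infinity>" using k by blast
  then show ?thesis
  proof cases
    case 1
    have "T1 \<Longrightarrow> fst ` D \<subseteq> {a0}" "T2 \<Longrightarrow> snd ` D \<subseteq> {b0}"
      using size_le_1D[of "fst ` D" _ a0] size_le_1D[of "snd ` D" _ b0] size 1 inD[OF D0] by blast+
    then have "T1 \<longrightarrow> fst ` {x0} = fst ` D" "T2 \<longrightarrow> snd ` {x0} = snd ` D"
      using inD[OF D0] ab by auto
    moreover have "size_le k {x0}"
      by (rule size_le_card) (auto simp: 1 one_enat_def)
    ultimately show ?thesis
      using x0 by (intro exI[of _ "{x0}"]) simp
  next
    case 2
    have t1: "fst ` D \<subseteq> {a0, a}" if T1 "a \<in> fst ` D" "a \<noteq> a0" for a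
      by (intro subsetI size_le_2D[of "fst ` D"])
        (use size(1)[OF that(1)] 2 inD[OF D0] that in simp_all)
    have t2: "snd ` D \<subseteq> {b0, b}" if T2 "b \<in> snd ` D" "b \<noteq> b0" for b
      by (intro subsetI size_le_2D[of "snd ` D"])
        (use size(2)[OF that(1)] 2 inD[OF D0] that in simp_all)
    \<comment> \<open>One pair beside \<open>x0\<close> has to supply the missing element on every
      side that must be covered.\<close>
    have "\<exists>a b. (a, b) \<in> D \<and> (T1 \<longrightarrow> fst ` D \<subseteq> {a0, a}) \<and> (T2 \<longrightarrow> snd ` D \<subseteq> {b0, b})"
    proof (cases "T1 \<and> (\<exists>a\<in>fst ` D. a \<noteq> a0)")
      case True
      then obtain a b where *: "T1" "(a, b) \<in> D" "a \<noteq> a0" by auto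
      note a = t1[OF *(1) inD(1)[OF *(2)] *(3)]
      show ?thesis
      proof (cases "T2 \<and> (\<exists>d\<in>snd ` D. d \<noteq> b0)")
        case True
        then obtain c d where **: "T2" "(c, d) \<in> D" "d \<noteq> b0" by auto
        note d = t2[OF **(1) inD(2)[OF **(2)] **(3)]
        have "c \<in> {a0, a}" "b \<in> {b0, d}"
          using a d inD[OF *(2)] inD[OF **(2)] by blast+
        then have "(a, d) \<in> D"
          using * ** D0 rect by blast
        then show ?thesis using a d by blast
      next
        case False
        then show ?thesis using * a by blast
      qed
    next
      case False
      note f1 = False
      show ?thesis
      proof (cases "T2 \<and> (\<exists>d\<in>snd ` D. d \<noteq> b0)")
        case True
        then obtain c d where **: "T2" "(c, d) \<in> D" "d \<noteq> b0" by auto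
        then show ?thesis
          using f1 t2[OF **(1) inD(2)[OF **(2)] **(3)] by blast
      next
        case False
        then show ?thesis using f1 D0 by blast
      qed
    qed
    then obtain a b where y: "(a, b) \<in> D" "T1 \<longrightarrow> fst ` D \<subseteq> {a0, a}" "T2 \<longrightarrow> snd ` D \<subseteq> {b0, b}"
      by blast
    have "size_le k {x0, (a, b)}"
      by (rule size_le_card) (auto simp: 2 numeral_eq_enat card_insert_if)
    moreover have "T1 \<longrightarrow> fst ` {x0, (a, b)} = fst ` D" "T2 \<longrightarrow> snd ` {x0, (a, b)} = snd ` D"
      using y inD[OF D0] inD[OF y(1)] ab by auto
    ultimately show ?thesis
      using x0 y(1) by (intro exI[of _ "{x0, (a, b)}"]) auto
  next
    case 3
    then show ?thesis
      using x0 size_le_infinity by blast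
  qed
qed

section \<open>Pairs of maximal consistent sets\<close>

locale amalgam = s4_logic +
  fixes A0 :: "nat set"
begin

abbreviation F :: "form set" where
  "F \<equiv> {\<chi>. atoms \<chi> \<subseteq> A0}"

definition P :: "(form set \<times> form set) set" where
  "P = {x. mcs (fst x) \<and> mcs (snd x) \<and> fst x \<inter> F = snd x \<inter> F}"

definition pR :: "(form set \<times> form set) rel" where
  "pR = {(x, y). x \<in> P \<and> y \<in> P \<and> (fst x, fst y) \<in> cR \<and> (snd x, snd y) \<in> cR}"

lemma P_mcs: "x \<in> P \<Longrightarrow> mcs (fst x)" "x \<in> P \<Longrightarrow> mcs (snd x)"
  by (auto simp: P_def)

lemma P_agree: "x \<in> P \<Longrightarrow> atoms \<chi> \<subseteq> A0 \<Longrightarrow> \<chi> \<in> fst x \<longleftrightarrow> \<chi> \<in> snd x"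
  by (auto simp: P_def)

lemma pR_P: "(x, y) \<in> pR \<Longrightarrow> x \<in> P" "(x, y) \<in> pR \<Longrightarrow> y \<in> P"
  by (auto simp: pR_def)

lemma pR_fst: "(x, y) \<in> pR \<Longrightarrow> (fst x, fst y) \<in> cR" and pR_snd: "(x, y) \<in> pR \<Longrightarrow> (snd x, snd y) \<in> cR"
  by (auto simp: pR_def)

lemma pR_refl: "x \<in> P \<Longrightarrow> (x, x) \<in> pR"
  using preorder_on_refl[OF preorder_cR] by (auto simp: pR_def P_def)

lemma pR_trans: "(x, y) \<in> pR \<Longrightarrow> (y, z) \<in> pR \<Longrightarrow> (x, z) \<in> pR"
  unfolding pR_def using cR_trans by blast

text \<open>Exchanging the components is a symmetry of the pair frame; \<open>lift_snd\<close> and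
  \<open>pmax_Top_cluster'\<close> are obtained from their first-component versions by it.\<close>

lemma swap_P: "prod.swap x \<in> P \<longleftrightarrow> x \<in> P"
  by (auto simp: P_def)

lemma swap_pR: "(prod.swap x, prod.swap y) \<in> pR \<longleftrightarrow> (x, y) \<in> pR"
  by (auto simp: pR_def swap_P)

text \<open>In the absence of a separating formula in \<open>F\<close>, first \<open>A2\<close> is
  completed together with all consequences of \<open>A1\<close> in \<open>F\<close>, then
  \<open>A1\<close> together with the trace of the result on \<open>F\<close>. Completeness makes
  the two traces equal.\<close>

lemma joint_lindenbaum:
  assumes sep: "\<And>\<chi>. \<chi> \<in> F \<Longrightarrow> A1 \<turnstile> \<chi> \<Longrightarrow> \<not> A2 \<turnstile> Neg \<chi>"
  obtains x where "x \<in> P" "A1 \<subseteq> fst x" "A2 \<subseteq> snd x"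
proof -
  let ?T = "{\<chi> \<in> F. A1 \<turnstile> \<chi>}"
  have "\<not> A2 \<union> ?T \<turnstile> Bot"
  proof
    assume bot: "A2 \<union> ?T \<turnstile> Bot"
    have "And \<chi> \<chi>' \<in> ?T" if "\<chi> \<in> ?T" "\<chi>' \<in> ?T" for \<chi> \<chi>'
      using that der_taut2[of A1 \<chi> \<chi>' "And \<chi> \<chi>'"] by simp
    moreover have "Top \<in> ?T"
      using der_taut[of Top] by simp
    ultimately obtain \<chi> where \<chi>: "\<chi> \<in> ?T" "A2 \<turnstile> Imp \<chi> Bot"
      using der_Un_conj[OF bot] by meson
    from \<chi>(2) have "A2 \<turnstile> Neg \<chi>"
      by (rule der_taut1) auto
    then show False
      using sep \<chi>(1) by blast
  qed
  then obtain t where t: "mcs t" "A2 \<union> ?T \<subseteq> t"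
    by (rule lindenbaum)
  \<comment> \<open>An inconsistency would make the negation of a member of \<open>t\<close> in
    \<open>F\<close> a consequence of \<open>A1\<close>, hence itself a member of
    \<open>t\<close>.\<close>
  have "\<not> A1 \<union> (t \<inter> F) \<turnstile> Bot"
  proof
    assume bot: "A1 \<union> (t \<inter> F) \<turnstile> Bot"
    obtain \<chi> where \<chi>: "\<chi> \<in> t \<inter> F" "A1 \<turnstile> Imp \<chi> Bot"
      using der_Un_conj[OF bot] t(1) by auto
    from \<chi>(2) have "A1 \<turnstile> Neg \<chi>"
      by (rule der_taut1) auto
    then have "Neg \<chi> \<in> ?T"
      using \<chi>(1) by simp
    then have "Neg \<chi> \<in> t"
      using t(2) by blast
    then show False
      using \<chi>(1) t(1) by simp
  qed
  then obtain s where s: "mcs s" "A1 \<union> (t \<inter> F) \<subseteq> s"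
    by (rule lindenbaum)
  have "\<chi> \<in> t" if "\<chi> \<in> s" "\<chi> \<in> F" for \<chi>
  proof (rule ccontr)
    assume "\<chi> \<notin> t"
    then have "Neg \<chi> \<in> t \<inter> F"
      using t(1) that by simp
    then have "Neg \<chi> \<in> s"
      using s(2) by blast
    then show False
      using s(1) that by simp
  qed
  then have "s \<inter> F = t \<inter> F"
    using s(2) by blast
  then show thesis
    using that[of "(s, t)"] s t by (simp add: P_def)
qed

text \<open>Back condition for the first projection. A formula \<open>\<chi>\<close> separating
  \<open>u\<close> from \<open>unbox (snd x)\<close> would put \<open>Box (Neg \<chi>)\<close> into
  \<open>snd x\<close>; as it lies in \<open>F\<close>, it passes to \<open>fst x\<close> and
  contradicts \<open>u\<close>.\<close>

lemma lift_fst: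
  assumes x: "x \<in> P" and u: "(fst x, u) \<in> cR"
  obtains y where "(x, y) \<in> pR" "fst y = u"
proof -
  have mu: "mcs u" and mx: "mcs (snd x)" "mcs (fst x)" and ub: "unbox (fst x) \<subseteq> u"
    using u x by (auto simp: cR_def P_def)
  have "\<not> unbox (snd x) \<turnstile> Neg \<chi>" if "\<chi> \<in> F" "u \<turnstile> \<chi>" for \<chi>
  proof
    assume "unbox (snd x) \<turnstile> Neg \<chi>"
    then have "Box (Neg \<chi>) \<in> snd x"
      using mcs_unbox[OF mx(1)] by (simp add: unbox_def)
    then have "Box (Neg \<chi>) \<in> fst x"
      using P_agree[OF x, of "Box (Neg \<chi>)"] that(1) by simp
    then have "Neg \<chi> \<in> u"
      using ub by (auto simp: unbox_def)
    then show False
      using that(2) mu by (simp add: mcs_der)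
  qed
  then obtain y where y: "y \<in> P" "u \<subseteq> fst y" "unbox (snd x) \<subseteq> snd y"
    using joint_lindenbaum by metis
  then have "fst y = u"
    using mcs_eq[OF mu P_mcs(1)[OF y(1)]] by simp
  then show thesis
    using that[of y] y x u P_mcs[OF y(1)] mx by (simp add: pR_def cR_def)
qed

lemma lift_snd:
  assumes x: "x \<in> P" and u: "(snd x, u) \<in> cR"
  obtains y where "(x, y) \<in> pR" "snd y = u"
proof -
  obtain y where "(prod.swap x, y) \<in> pR" "fst y = u"
    using lift_fst[of "prod.swap x" u] x u swap_P by auto
  then show thesis
    using that[of "prod.swap y"] swap_pR[of x "prod.swap y"] by simp
qed

section \<open>Maximal pairs and their clusters\<close>

definition pmax :: "form \<Rightarrow> form \<Rightarrow> form set \<times> form set \<Rightarrow> bool" where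
  "pmax a b y \<longleftrightarrow> y \<in> P \<and> a \<in> fst y \<and> b \<in> snd y \<and>
     (\<forall>z. (y, z) \<in> pR \<longrightarrow> a \<in> fst z \<longrightarrow> b \<in> snd z \<longrightarrow> (z, y) \<in> pR)"

lemma swap_pmax: "pmax a b (prod.swap y) \<longleftrightarrow> pmax b a y"
proof -
  have "(\<forall>z. (prod.swap y, z) \<in> pR \<longrightarrow> a \<in> fst z \<longrightarrow> b \<in> snd z \<longrightarrow> (z, prod.swap y) \<in> pR) \<longleftrightarrow>
        (\<forall>z. (y, z) \<in> pR \<longrightarrow> b \<in> fst z \<longrightarrow> a \<in> snd z \<longrightarrow> (z, y) \<in> pR)"
    by (metis swap_pR swap_swap fst_swap snd_swap)
  then show ?thesis
    unfolding pmax_def swap_P by auto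
qed

text \<open>Zorn's lemma for a preorder: pairs are encoded by the boxes they contain, which turns
  \<open>pR\<close> into inclusion. A chain has an upper bound because a separating formula would,
  by compactness, already separate the components of one pair in the chain.\<close>

lemma pmax_exists:
  assumes x: "x \<in> P" "a \<in> fst x" "b \<in> snd x"
  obtains y where "(x, y) \<in> pR" "pmax a b y"
proof -
  define N :: "form set \<times> form set \<Rightarrow> (form + form) set"
    where "N y = unbox (fst y) <+> unbox (snd y)" for y
  have N: "(y, z) \<in> pR \<longleftrightarrow> y \<in> P \<and> z \<in> P \<and> N y \<subseteq> N z" for y z
  proof -
    have "N y \<subseteq> N z \<longleftrightarrow> unbox (fst y) \<subseteq> unbox (fst z) \<and> unbox (snd y) \<subseteq> unbox (snd z)"
      by (auto simp: N_def)
    then show ?thesis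
      by (auto simp: pR_def cR_unbox P_mcs)
  qed
  let ?X = "N ` {y. (x, y) \<in> pR \<and> a \<in> fst y \<and> b \<in> snd y}"
  have "\<exists>M\<in>?X. \<forall>X\<in>?X. M \<subseteq> X \<longrightarrow> X = M"
  proof (rule subset_Zorn)
    fix C assume C: "subset.chain ?X C"
    show "\<exists>U\<in>?X. \<forall>X\<in>C. X \<subseteq> U"
    proof (cases "C = {}")
      case True
      then show ?thesis
        using x pR_refl by blast
    next
      case False
      have C_sub: "C \<subseteq> ?X" and C_lin: "\<And>c d. c \<in> C \<Longrightarrow> d \<in> C \<Longrightarrow> c \<subseteq> d \<or> d \<subseteq> c"
        using C by (auto simp: subset_chain_def)
      \<comment> \<open>Adding \<open>a\<close> and \<open>b\<close> to the unboxed formulas forces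
        the upper bound to contain them too.\<close>
      define f1 where "f1 c = insert a (Inl -` c)" for c :: "(form + form) set"
      define f2 where "f2 c = insert b (Inr -` c)" for c :: "(form + form) set"
      have mono: "f1 c \<subseteq> f1 d" "f2 c \<subseteq> f2 d" if "c \<subseteq> d" for c d
        using that by (auto simp: f1_def f2_def)
      have lin: "A \<in> f1 ` C \<Longrightarrow> B \<in> f1 ` C \<Longrightarrow> A \<subseteq> B \<or> B \<subseteq> A"
        "A \<in> f2 ` C \<Longrightarrow> B \<in> f2 ` C \<Longrightarrow> A \<subseteq> B \<or> B \<subseteq> A" for A B
        using C_lin mono by (metis imageE)+
      have "\<not> \<Union>(f2 ` C) \<turnstile> Neg \<chi>" if \<chi>: "\<chi> \<in> F" "\<Union>(f1 ` C) \<turnstile> \<chi>" for \<chi>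
      proof
        assume "\<Union>(f2 ` C) \<turnstile> Neg \<chi>"
        then have "\<exists>A\<in>f2 ` C. A \<turnstile> Neg \<chi>"
          using False lin(2) by (intro ded_Union_chain) auto
        moreover have "\<exists>A\<in>f1 ` C. A \<turnstile> \<chi>"
          using \<chi>(2) False lin(1) by (intro ded_Union_chain) auto
        ultimately obtain c d where cd: "c \<in> C" "d \<in> C" "f1 c \<turnstile> \<chi>" "f2 d \<turnstile> Neg \<chi>"
          by blast
        have "\<exists>e\<in>C. f1 c \<subseteq> f1 e \<and> f2 d \<subseteq> f2 e"
        proof (cases "c \<subseteq> d")
          case True
          then show ?thesis using cd(2) mono(1) by blast
        next
          case False
          then have "d \<subseteq> c" using C_lin[OF cd(1,2)] by simp
          then show ?thesis using cd(1) mono(2) by blast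
        qed
        then obtain e where e: "e \<in> C" "f1 e \<turnstile> \<chi>" "f2 e \<turnstile> Neg \<chi>"
          using ded_mono[OF cd(3)] ded_mono[OF cd(4)] by auto
        have "e \<in> ?X" using C_sub e(1) by (rule subsetD)
        then obtain y where y: "e = N y" "y \<in> P" "a \<in> fst y" "b \<in> snd y"
          by (auto dest: pR_P)
        have sub: "f1 e \<subseteq> fst y" "f2 e \<subseteq> snd y"
          using y unbox_sub P_mcs[OF y(2)] by (auto simp: f1_def f2_def N_def)
        have "\<chi> \<in> fst y" "Neg \<chi> \<in> snd y"
          using ded_mono[OF e(2) sub(1)] ded_mono[OF e(3) sub(2)] P_mcs[OF y(2)]
          by (simp_all only: mcs_der)
        then show False
          using P_agree[OF y(2), of \<chi>] \<chi>(1) P_mcs[OF y(2)] by simp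
      qed
      then obtain z where z: "z \<in> P" "\<Union>(f1 ` C) \<subseteq> fst z" "\<Union>(f2 ` C) \<subseteq> snd z"
        using joint_lindenbaum by metis
      have above: "(y, z) \<in> pR" if "N y \<in> C" "y \<in> P" for y
      proof -
        have "f1 (N y) \<subseteq> fst z" "f2 (N y) \<subseteq> snd z"
          using z that(1) by blast+
        then show ?thesis
          using that(2) z(1) P_mcs by (auto simp: pR_def cR_def f1_def f2_def N_def)
      qed
      obtain c where "c \<in> C" using False by blast
      then obtain y where y: "N y \<in> C" "(x, y) \<in> pR"
        using C_sub by blast
      have "(x, z) \<in> pR"
        using pR_trans[OF y(2) above[OF y(1) pR_P(2)[OF y(2)]]] .
      moreover have "a \<in> fst z" "b \<in> snd z"
        using z(2,3) y(1) by (auto simp: f1_def f2_def)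
      ultimately have "N z \<in> ?X" by blast
      moreover have "X \<subseteq> N z" if "X \<in> C" for X
      proof -
        obtain y where "X = N y" "(x, y) \<in> pR"
          using C_sub \<open>X \<in> C\<close> by blast
        then show ?thesis
          using above[of y] that pR_P(2) N by blast
      qed
      ultimately show ?thesis by blast
    qed
  qed
  then obtain U where U: "U \<in> ?X" "\<forall>X\<in>?X. U \<subseteq> X \<longrightarrow> X = U"
    by (rule bexE)
  from U(1) obtain y where U_eq: "U = N y" and y: "(x, y) \<in> pR" "a \<in> fst y" "b \<in> snd y"
    by auto
  have max: "N z = N y" if "(x, z) \<in> pR" "a \<in> fst z" "b \<in> snd z" "N y \<subseteq> N z" for z
    using U(2)[rule_format, of "N z"] that U_eq by blast
  \<comment> \<open>Equal encodings mean mutual accessibility, which is the form of maximality in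
    \<open>pmax\<close>.\<close>
  have "(z, y) \<in> pR" if "(y, z) \<in> pR" "a \<in> fst z" "b \<in> snd z" for z
    using max[OF pR_trans[OF y(1) that(1)] that(2,3)] that(1) N by auto
  then have "pmax a b y"
    using y pR_P(2) by (auto simp: pmax_def)
  then show thesis
    using that y(1) by blast
qed

text \<open>With \<open>Top\<close> on the second side only the first component is constrained, so
  lifting along the first projection transfers maximality and finality from \<open>y\<close> to
  \<open>fst y\<close>, where \<open>cluster_bound\<close> applies.\<close>

lemma pmax_Top_cluster:
  assumes y: "pmax a Top y" and gam: "gam m \<in> L" "gam_bar n \<in> L"
  shows "size_le (if final P pR y then m else n) (fst ` cluster P pR y)"
proof -
  have yP: "y \<in> P" "a \<in> fst y"
    using y by (auto simp: pmax_def)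
  have ret: "(z, y) \<in> pR" if "(y, z) \<in> pR" "a \<in> fst z" for z
    using y that mcs_Top[OF P_mcs(2)[OF pR_P(2)[OF that(1)]]] unfolding pmax_def by blast
  have max: "(u, fst y) \<in> cR" if u: "(fst y, u) \<in> cR" "a \<in> u" for u
  proof -
    obtain z where "(y, z) \<in> pR" "fst z = u"
      using lift_fst[OF yP(1) u(1)] .
    then show ?thesis
      using pR_fst[OF ret[of z]] u(2) by simp
  qed
  have "final M cR (fst y) \<longleftrightarrow> final P pR y"
  proof
    assume fin: "final M cR (fst y)"
    show "final P pR y"
      unfolding final_def
    proof (intro ballI impI)
      fix z assume z: "z \<in> P" "(y, z) \<in> pR"
      then have "(fst z, fst y) \<in> cR"
        using fin P_mcs(1)[OF z(1)] by (simp add: final_def pR_def)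
      then obtain w where w: "(z, w) \<in> pR" "fst w = fst y"
        using lift_fst[OF z(1)] by metis
      then show "(z, y) \<in> pR"
        using ret[OF pR_trans[OF z(2) w(1)]] yP(2) pR_trans by simp
    qed
  next
    assume fin: "final P pR y"
    show "final M cR (fst y)"
      unfolding final_def
    proof (intro ballI impI)
      fix u assume "(fst y, u) \<in> cR"
      then obtain z where z: "(y, z) \<in> pR" "fst z = u"
        using lift_fst[OF yP(1)] by metis
      then have "(z, y) \<in> pR"
        using fin pR_P(2)[OF z(1)] by (simp add: final_def)
      then show "(u, fst y) \<in> cR"
        using pR_fst[of z y] z(2) by simp
    qed
  qed
  moreover have "fst ` cluster P pR y \<subseteq> cluster M cR (fst y)"
    using P_mcs(1) by (auto simp: cluster_def pR_def)
  moreover have "size_le (if final M cR (fst y) then m else n) (cluster M cR (fst y))"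
    by (rule cluster_bound[OF P_mcs(1)[OF yP(1)] yP(2) _ gam]) (rule max)
  ultimately show ?thesis
    using size_le_mono[of _ _ "fst ` cluster P pR y"] by simp
qed

lemma pmax_Top_cluster':
  assumes y: "pmax Top b y" and gam: "gam m \<in> L" "gam_bar n \<in> L"
  shows "size_le (if final P pR y then m else n) (snd ` cluster P pR y)"
proof -
  have *: "(prod.swap x, y) \<in> pR \<longleftrightarrow> (x, prod.swap y) \<in> pR" for x y
    by (metis swap_pR swap_swap)
  have "final P pR (prod.swap y) \<longleftrightarrow> final P pR y"
    unfolding final_def by (metis swap_P swap_pR swap_swap)
  moreover have "fst ` cluster P pR (prod.swap y) = snd ` cluster P pR y"
  proof -
    have "cluster P pR (prod.swap y) = prod.swap ` cluster P pR y"
    proof (intro set_eqI iffI)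
      fix z assume "z \<in> cluster P pR (prod.swap y)"
      then have "prod.swap z \<in> cluster P pR y"
        unfolding cluster_def using swap_P swap_pR[of y "prod.swap z"] swap_pR[of "prod.swap z" y]
        by auto
      then show "z \<in> prod.swap ` cluster P pR y"
        by (rule rev_image_eqI) simp
    qed (auto simp: cluster_def swap_P swap_pR simp del: swap_simp)
    then show ?thesis
      by (simp add: image_image)
  qed
  ultimately show ?thesis
    using pmax_Top_cluster[OF _ gam, of b "prod.swap y"] y by (simp add: swap_pmax)
qed

section \<open>Selection of points from a cluster\<close>

lemma cluster_eq: "y \<in> cluster P pR x \<Longrightarrow> cluster P pR y = cluster P pR x"
  unfolding cluster_def using pR_trans by blast

lemma final_cluster: "y \<in> cluster P pR x \<Longrightarrow> final P pR y \<longleftrightarrow> final P pR x"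
  unfolding cluster_def final_def using pR_trans by blast

lemma cluster_self: "x \<in> P \<Longrightarrow> x \<in> cluster P pR x"
  by (simp add: cluster_def pR_refl)

text \<open>The three given pairs force all four components to have the same trace on
  \<open>F\<close>, so \<open>(a, d)\<close> is a pair; accessibility is componentwise.\<close>

lemma cluster_rectangular:
  assumes "(a, b) \<in> cluster P pR x" "(c, b) \<in> cluster P pR x" "(c, d) \<in> cluster P pR x"
  shows "(a, d) \<in> cluster P pR x"
proof -
  have "(a, d) \<in> P"
    using assms by (auto simp: cluster_def P_def)
  then show ?thesis
    using assms by (auto simp: cluster_def pR_def)
qed

text \<open>All components on a side must survive only if the cluster has a pair maximal for a
  formula on that side alone; then that side obeys the bound, as
  \<open>rectangular_selection\<close> requires.\<close>

lemma selection:
  assumes gam: "gam m \<in> L" "gam_bar n \<in> L" and mn: "m \<in> {1, 2, \<infinity>}" "n \<in> {1, 2, \<infinity>}"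
    and x: "x \<in> P"
  shows "\<exists>S \<subseteq> cluster P pR x. (w \<in> cluster P pR x \<longrightarrow> w \<in> S) \<and>
    (\<forall>y\<in>cluster P pR x. \<forall>c. pmax c Top y \<longrightarrow> fst y \<in> fst ` S) \<and>
    (\<forall>y\<in>cluster P pR x. \<forall>c. pmax Top c y \<longrightarrow> snd y \<in> snd ` S) \<and>
    size_le (if final P pR x then m else n) S"
proof -
  let ?D = "cluster P pR x" and ?k = "if final P pR x then m else n"
  define T1 where "T1 \<longleftrightarrow> (\<exists>y\<in>?D. \<exists>c. pmax c Top y)"
  define T2 where "T2 \<longleftrightarrow> (\<exists>y\<in>?D. \<exists>c. pmax Top c y)"
  \<comment> \<open>The distinguished pair \<open>w\<close> is the base point if it lies in this
    cluster, so that it survives the selection.\<close>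
  define x0 where "x0 = (if w \<in> ?D then w else x)"
  have "x0 \<in> ?D"
    using cluster_self[OF x] by (simp add: x0_def)
  moreover note cluster_rectangular
  moreover have "?k \<in> {1, 2, \<infinity>}"
    using mn by simp
  moreover have "size_le ?k (fst ` ?D)" if t: T1
  proof -
    obtain y c where y: "y \<in> ?D" "pmax c Top y"
      using t unfolding T1_def by blast
    show ?thesis
      using pmax_Top_cluster[OF y(2) gam] cluster_eq[OF y(1)] final_cluster[OF y(1)] by simp
  qed
  moreover have "size_le ?k (snd ` ?D)" if t: T2
  proof -
    obtain y c where y: "y \<in> ?D" "pmax Top c y"
      using t unfolding T2_def by blast
    show ?thesis
      using pmax_Top_cluster'[OF y(2) gam] cluster_eq[OF y(1)] final_cluster[OF y(1)] by simp
  qed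
  ultimately have "\<exists>S\<subseteq>?D. x0 \<in> S \<and> (T1 \<longrightarrow> fst ` S = fst ` ?D) \<and> (T2 \<longrightarrow> snd ` S = snd ` ?D) \<and> size_le ?k S"
    by (rule rectangular_selection)
  then obtain S where "S \<subseteq> ?D \<and> x0 \<in> S \<and> (T1 \<longrightarrow> fst ` S = fst ` ?D) \<and>
      (T2 \<longrightarrow> snd ` S = snd ` ?D) \<and> size_le ?k S"
    by (rule exE)
  then have S: "S \<subseteq> ?D" "x0 \<in> S" "T1 \<longrightarrow> fst ` S = fst ` ?D" "T2 \<longrightarrow> snd ` S = snd ` ?D"
      "size_le ?k S"
    by simp_all
  have "w \<in> ?D \<longrightarrow> w \<in> S"
    using S(2) by (auto simp: x0_def)
  moreover have "\<forall>y\<in>?D. \<forall>c. pmax c Top y \<longrightarrow> fst y \<in> fst ` S"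
  proof (intro ballI allI impI)
    fix y c assume y: "y \<in> ?D" "pmax c Top y"
    then have T1 unfolding T1_def by (intro bexI exI)
    then show "fst y \<in> fst ` S" using S(3) y(1) by simp
  qed
  moreover have "\<forall>y\<in>?D. \<forall>c. pmax Top c y \<longrightarrow> snd y \<in> snd ` S"
  proof (intro ballI allI impI)
    fix y c assume y: "y \<in> ?D" "pmax Top c y"
    then have T2 unfolding T2_def by (intro bexI exI)
    then show "snd y \<in> snd ` S" using S(4) y(1) by simp
  qed
  ultimately show ?thesis
    using S(1,5) by (intro exI[of _ S] conjI)
qed

section \<open>The selected frame\<close>

text \<open>\<open>B1\<close> and \<open>B2\<close> hold the box bodies whose witnesses must survive
  on either side; their finiteness bounds the depth of the frame.\<close>

lemma selected_frame:
  assumes gam: "gam m \<in> L" "gam_bar n \<in> L" and mn: "m \<in> {1, 2, \<infinity>}" "n \<in> {1, 2, \<infinity>}"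
    and w0: "w0 \<in> P" "a \<in> fst w0" "b \<in> snd w0"
    and fin: "finite B1" "finite B2"
  obtains W R where "W \<subseteq> P" "R = pR \<inter> W \<times> W" "\<exists>w\<in>W. a \<in> fst w \<and> b \<in> snd w"
    "\<And>x \<beta>. x \<in> W \<Longrightarrow> \<beta> \<in> B1 \<Longrightarrow> Box \<beta> \<notin> fst x \<Longrightarrow> \<exists>y\<in>W. (x, y) \<in> pR \<and> \<beta> \<notin> fst y"
    "\<And>x \<beta>. x \<in> W \<Longrightarrow> \<beta> \<in> B2 \<Longrightarrow> Box \<beta> \<notin> snd x \<Longrightarrow> \<exists>y\<in>W. (x, y) \<in> pR \<and> \<beta> \<notin> snd y"
    "preorder_on W R" "frame_valid W R (gam m)" "frame_valid W R (gam_bar n)"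
    "dot2 \<in> L \<Longrightarrow> confluent W R"
proof -
  \<comment> \<open>The pair \<open>(Top, Top)\<close> brings a final cluster above every point,
    \<open>(a, b)\<close> keeps the pair to be preserved, and the rest supply witnesses for refuted
    boxes on either side.\<close>
  define T where "T = insert (Top, Top) (insert (a, b)
    ((\<lambda>\<beta>. (Neg \<beta>, Top)) ` B1 \<union> (\<lambda>\<beta>. (Top, Neg \<beta>)) ` B2))"
  have T: "(Top, Top) \<in> T" "(a, b) \<in> T" "\<And>\<beta>. \<beta> \<in> B1 \<Longrightarrow> (Neg \<beta>, Top) \<in> T"
      "\<And>\<beta>. \<beta> \<in> B2 \<Longrightarrow> (Top, Neg \<beta>) \<in> T"
    by (auto simp: T_def)
  have "finite T"
    using fin by (simp add: T_def)
  obtain w where w: "pmax a b w"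
    using pmax_exists[OF w0] .
  let ?cl = "cluster P pR"
  \<comment> \<open>Selection is a function of the cluster \<open>D\<close>, so that all its points
    share one choice. Finality is constant on \<open>D\<close>, hence the bound may range over all
    of it.\<close>
  define good where "good D S \<longleftrightarrow> S \<subseteq> D \<and> (w \<in> D \<longrightarrow> w \<in> S) \<and>
    (\<forall>y\<in>D. \<forall>c. pmax c Top y \<longrightarrow> fst y \<in> fst ` S) \<and>
    (\<forall>y\<in>D. \<forall>c. pmax Top c y \<longrightarrow> snd y \<in> snd ` S) \<and>
    (\<forall>x\<in>D. size_le (if final P pR x then m else n) S)" for D S
  define sel where "sel D = (SOME S. good D S)" for D
  have sel: "good (?cl x) (sel (?cl x))" if xP: "x \<in> P" for x
  proof -
    obtain S where S: "S \<subseteq> ?cl x \<and> (w \<in> ?cl x \<longrightarrow> w \<in> S) \<and>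
        (\<forall>y\<in>?cl x. \<forall>c. pmax c Top y \<longrightarrow> fst y \<in> fst ` S) \<and>
        (\<forall>y\<in>?cl x. \<forall>c. pmax Top c y \<longrightarrow> snd y \<in> snd ` S) \<and>
        size_le (if final P pR x then m else n) S"
      using selection[OF gam mn xP, of w] by (rule exE)
    have "\<forall>y\<in>?cl x. size_le (if final P pR y then m else n) S"
    proof
      fix y assume "y \<in> ?cl x"
      then show "size_le (if final P pR y then m else n) S"
        using S final_cluster[of y x] by simp
    qed
    with S have "good (?cl x) S"
      unfolding good_def by (elim conjE, intro conjI)
    then show ?thesis
      unfolding sel_def by (rule someI)
  qed
  define W where "W = {x \<in> P. x \<in> sel (?cl x) \<and> (\<exists>(c, d)\<in>T. \<exists>y\<in>?cl x. pmax c d y)}"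
  define R where "R = pR \<inter> W \<times> W"
  have WP: "x \<in> P" if "x \<in> W" for x
    using that by (simp add: W_def)
  \<comment> \<open>A selected point has the same cluster as \<open>y\<close>, so it inherits both
    the selection and the requirement that \<open>y\<close> meets.\<close>
  have inW: "z \<in> W" "(y, z) \<in> pR" if y: "pmax c d y" "(c, d) \<in> T" and z: "z \<in> sel (?cl y)" for c d y z
  proof -
    have yP: "y \<in> P" using y by (simp add: pmax_def)
    have zc: "z \<in> ?cl y"
      using sel[OF yP] z by (auto simp: good_def)
    have "?cl z = ?cl y" "y \<in> ?cl z" "z \<in> P"
      using cluster_eq[OF zc] cluster_self[OF yP] zc by (auto simp: cluster_def)
    then show "z \<in> W"
      using y z unfolding W_def by auto
    show "(y, z) \<in> pR"
      using zc by (simp add: cluster_def)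
  qed
  have wW: "w \<in> W"
  proof (rule inW(1)[OF w T(2)])
    have "w \<in> P" using w by (simp add: pmax_def)
    then show "w \<in> sel (?cl w)"
      using sel[of w] cluster_self[of w] by (simp add: good_def)
  qed
  have pre: "preorder_on W R"
    unfolding preorder_on_def refl_on_def trans_def R_def using WP pR_refl pR_trans by blast
  \<comment> \<open>The witness in the canonical model is lifted to a pair, raised to one maximal
    for \<open>(Neg \<beta>, Top)\<close>, and replaced by a selected pair with the same first
    component.\<close>
  have wit1: "\<exists>y\<in>W. (x, y) \<in> pR \<and> \<beta> \<notin> fst y" if x: "x \<in> W" "\<beta> \<in> B1" "Box \<beta> \<notin> fst x" for x \<beta>
  proof -
    obtain u where u: "(fst x, u) \<in> cR" "\<beta> \<notin> u"
      using cR_witness[OF P_mcs(1)[OF WP[OF x(1)]] x(3)] .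
    obtain v where v: "(x, v) \<in> pR" "fst v = u"
      using lift_fst[OF WP[OF x(1)] u(1)] .
    have vP: "v \<in> P" using pR_P(2)[OF v(1)] .
    obtain y where y: "(v, y) \<in> pR" "pmax (Neg \<beta>) Top y"
      using pmax_exists[OF vP, of "Neg \<beta>" Top] u(2) v(2) P_mcs[OF vP] by auto
    have yP: "y \<in> P" "Neg \<beta> \<in> fst y" using y(2) by (auto simp: pmax_def)
    have "fst y \<in> fst ` sel (?cl y)"
      using sel[OF yP(1)] cluster_self[OF yP(1)] y(2) unfolding good_def by blast
    then obtain z where z: "z \<in> sel (?cl y)" "fst z = fst y"
      by (metis imageE)
    note zW = inW[OF y(2) T(3)[OF x(2)] z(1)]
    have "\<beta> \<notin> fst z"
      using yP z(2) P_mcs(1)[OF yP(1)] by simp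
    then show ?thesis
      using zW pR_trans[OF pR_trans[OF v(1) y(1)] zW(2)] by blast
  qed
  have wit2: "\<exists>y\<in>W. (x, y) \<in> pR \<and> \<beta> \<notin> snd y" if x: "x \<in> W" "\<beta> \<in> B2" "Box \<beta> \<notin> snd x" for x \<beta>
  proof -
    obtain u where u: "(snd x, u) \<in> cR" "\<beta> \<notin> u"
      using cR_witness[OF P_mcs(2)[OF WP[OF x(1)]] x(3)] .
    obtain v where v: "(x, v) \<in> pR" "snd v = u"
      using lift_snd[OF WP[OF x(1)] u(1)] .
    have vP: "v \<in> P" using pR_P(2)[OF v(1)] .
    obtain y where y: "(v, y) \<in> pR" "pmax Top (Neg \<beta>) y"
      using pmax_exists[OF vP, of Top "Neg \<beta>"] u(2) v(2) P_mcs[OF vP] by auto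
    have yP: "y \<in> P" "Neg \<beta> \<in> snd y" using y(2) by (auto simp: pmax_def)
    have "snd y \<in> snd ` sel (?cl y)"
      using sel[OF yP(1)] cluster_self[OF yP(1)] y(2) unfolding good_def by blast
    then obtain z where z: "z \<in> sel (?cl y)" "snd z = snd y"
      by (metis imageE)
    note zW = inW[OF y(2) T(4)[OF x(2)] z(1)]
    have "\<beta> \<notin> snd z"
      using yP z(2) P_mcs(2)[OF yP(1)] by simp
    then show ?thesis
      using zW pR_trans[OF pR_trans[OF v(1) y(1)] zW(2)] by blast
  qed
  \<comment> \<open>A pair maximal for \<open>(Top, Top)\<close> is final, and its cluster has a
    selected point.\<close>
  have final_above: "\<exists>z\<in>W. (x, z) \<in> pR \<and> final P pR z" if x: "x \<in> W" for x
  proof -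
    obtain y where y: "(x, y) \<in> pR" "pmax Top Top y"
      using pmax_exists[OF WP[OF x], of Top Top] P_mcs[OF WP[OF x]] by auto
    have yP: "y \<in> P" using pR_P(2)[OF y(1)] .
    have "(z, y) \<in> pR" if "(y, z) \<in> pR" for z
      using y(2) that P_mcs[OF pR_P(2)[OF that]] mcs_Top unfolding pmax_def by blast
    then have "final P pR y"
      by (simp add: final_def)
    moreover have "fst y \<in> fst ` sel (?cl y)"
      using sel[OF yP(1)] cluster_self[OF yP(1)] y(2) unfolding good_def by blast
    then obtain z where z: "z \<in> sel (?cl y)"
      by (metis imageE)
    moreover have "z \<in> ?cl y"
      using sel[OF yP] z by (auto simp: good_def)
    ultimately have "final P pR z"
      using final_cluster by simp
    then show ?thesis
      using inW[OF y(2) T(1) z] pR_trans[OF y(1)] by blast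
  qed
  \<comment> \<open>The selections were bounded according to finality in \<open>P\<close>, whereas
    the frame formulas are governed by finality in \<open>W\<close>.\<close>
  have final_iff: "final W R x \<longleftrightarrow> final P pR x" if x: "x \<in> W" for x
  proof
    assume "final P pR x"
    then show "final W R x"
      using WP x by (simp add: final_def R_def)
  next
    assume fx: "final W R x"
    obtain z where z: "z \<in> W" "(x, z) \<in> pR" "final P pR z"
      using final_above[OF x] by blast
    then have "(z, x) \<in> pR"
      using fx x by (simp add: final_def R_def)
    then have "x \<in> ?cl z"
      using z(2) WP[OF x] by (simp add: cluster_def)
    then show "final P pR x"
      using z(3) final_cluster by simp
  qed
  have size: "size_le (if final W R x then m else n) (cluster W R x)" if x: "x \<in> W" for x
  proof -
    have "y \<in> sel (?cl x)" if "y \<in> cluster W R x" for y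
    proof -
      have "y \<in> W" "y \<in> ?cl x"
        using that WP by (auto simp: cluster_def R_def)
      then show ?thesis
        using cluster_eq by (auto simp: W_def)
    qed
    then have "cluster W R x \<subseteq> sel (?cl x)" by (rule subsetI)
    moreover have "size_le (if final P pR x then m else n) (sel (?cl x))"
      using sel[OF WP[OF x]] cluster_self[OF WP[OF x]] unfolding good_def by blast
    ultimately show ?thesis
      unfolding final_iff[OF x] by (rule size_le_mono[rotated])
  qed
  text \<open>The rank of \<open>x\<close> is \<open>card (Q x)\<close>: a pair in \<open>T\<close> that selects the cluster of \<open>x\<close> is not realised
    strictly above \<open>x\<close>.\<close>
  define Q where "Q x = {(c, d) \<in> T. \<exists>z. (x, z) \<in> pR \<and> c \<in> fst z \<and> d \<in> snd z}" for x
  have rank: "card (Q y) < card (Q x)" if xy: "x \<in> W" "(x, y) \<in> R" "(y, x) \<notin> R" for x y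
  proof (rule psubset_card_mono)
    show "finite (Q x)"
      using \<open>finite T\<close> by (rule rev_finite_subset) (auto simp: Q_def)
    have xyp: "(x, y) \<in> pR" "(y, x) \<notin> pR"
      using xy by (auto simp: R_def)
    obtain c d u where u: "(c, d) \<in> T" "u \<in> ?cl x" "pmax c d u"
      using xy(1) by (auto simp: W_def)
    have "(c, d) \<in> Q x"
      using u unfolding Q_def cluster_def pmax_def by blast
    moreover have "(c, d) \<notin> Q y"
    proof
      assume "(c, d) \<in> Q y"
      then obtain z where z: "(y, z) \<in> pR" "c \<in> fst z" "d \<in> snd z"
        unfolding Q_def by blast
      have ux: "(x, u) \<in> pR" "(u, x) \<in> pR"
        using u(2) by (auto simp: cluster_def)
      have "(u, z) \<in> pR"
        using pR_trans[OF ux(2) pR_trans[OF xyp(1) z(1)]] .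
      then have "(z, u) \<in> pR"
        using u(3) z(2,3) unfolding pmax_def by blast
      then have "(y, x) \<in> pR"
        using pR_trans[OF z(1) pR_trans[OF _ ux(2)]] by blast
      then show False using xyp by simp
    qed
    moreover have "Q y \<subseteq> Q x"
      using pR_trans[OF xyp(1)] unfolding Q_def by blast
    ultimately show "Q y \<subset> Q x" by blast
  qed
  have "frame_valid W R (gam m)"
  proof (rule frame_valid_gam[OF pre, where rk = "\<lambda>x. card (Q x)"])
    show "size_le m (cluster W R x)" if "x \<in> W" "final W R x" for x
      using size[OF that(1)] that(2) by simp
  qed (rule rank)
  moreover have "frame_valid W R (gam_bar n)"
  proof (rule frame_valid_gam_bar[OF pre, where rk = "\<lambda>x. card (Q x)"])
    show "size_le n (cluster W R x)" if "x \<in> W" "\<not> final W R x" for x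
      using size[OF that(1)] that(2) by simp
  qed (rule rank)
  moreover have "confluent W R" if dot2: "dot2 \<in> L"
  proof -
    note conf = confluent_cR[OF dot2, unfolded confluent_def, rule_format]
    have "\<exists>u\<in>W. (y, u) \<in> pR \<and> (z, u) \<in> pR"
      if x: "x \<in> W" "y \<in> W" "z \<in> W" "(x, y) \<in> pR" "(x, z) \<in> pR" for x y z
    proof -
      \<comment> \<open>Two final pairs above \<open>x\<close> are compared componentwise:
        confluence of the canonical frame gives a common successor \<open>u\<close> of their
        components, and finality of \<open>y'\<close> leads from \<open>u\<close> back to
        \<open>y'\<close>. Both components together give an arrow from \<open>z'\<close> to
        \<open>y'\<close>.\<close>
      obtain y' where y': "y' \<in> W" "(y, y') \<in> pR" "final P pR y'"
        using final_above[OF x(2)] by blast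
      obtain z' where z': "z' \<in> W" "(z, z') \<in> pR" "final P pR z'"
        using final_above[OF x(3)] by blast
      note xy' = pR_trans[OF x(4) y'(2)] and xz' = pR_trans[OF x(5) z'(2)]
      have mem: "fst x \<in> M" "snd x \<in> M" "fst y' \<in> M" "snd y' \<in> M" "fst z' \<in> M" "snd z' \<in> M"
        using P_mcs WP x(1) y'(1) z'(1) by simp_all
      obtain u where u: "(fst y', u) \<in> cR" "(fst z', u) \<in> cR"
        using conf[OF mem(1,3,5) pR_fst[OF xy'] pR_fst[OF xz']] by blast
      obtain v where v: "(y', v) \<in> pR" "fst v = u"
        using lift_fst[OF WP[OF y'(1)] u(1)] .
      have "(v, y') \<in> pR"
        using y'(3) v(1) pR_P(2)[OF v(1)] by (simp add: final_def)
      then have 1: "(fst z', fst y') \<in> cR"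
        using u(2) v(2) cR_trans pR_fst by blast
      obtain u where u: "(snd y', u) \<in> cR" "(snd z', u) \<in> cR"
        using conf[OF mem(2,4,6) pR_snd[OF xy'] pR_snd[OF xz']] by blast
      obtain v where v: "(y', v) \<in> pR" "snd v = u"
        using lift_snd[OF WP[OF y'(1)] u(1)] .
      have "(v, y') \<in> pR"
        using y'(3) v(1) pR_P(2)[OF v(1)] by (simp add: final_def)
      then have 2: "(snd z', snd y') \<in> cR"
        using u(2) v(2) cR_trans pR_snd by blast
      have "(z', y') \<in> pR"
        using 1 2 WP y'(1) z'(1) by (simp add: pR_def)
      then show ?thesis
        using y' z' pR_trans by blast
    qed
    then show ?thesis
      unfolding confluent_def R_def by blast
  qed
  moreover have "W \<subseteq> P" using WP by blast
  moreover have "\<exists>w\<in>W. a \<in> fst w \<and> b \<in> snd w"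
    using wW w by (auto simp: pmax_def)
  ultimately show thesis
    using that[OF _ R_def _ wit1 wit2 pre] by blast
qed

end

section \<open>Truth lemma and interpolation\<close>

primrec box_bodies :: "form \<Rightarrow> form set" where
  "box_bodies (Atom p) = {}"
| "box_bodies Bot = {}"
| "box_bodies Top = {}"
| "box_bodies (Neg \<phi>) = box_bodies \<phi>"
| "box_bodies (Box \<phi>) = insert \<phi> (box_bodies \<phi>)"
| "box_bodies (And \<phi> \<psi>) = box_bodies \<phi> \<union> box_bodies \<psi>"
| "box_bodies (Or \<phi> \<psi>) = box_bodies \<phi> \<union> box_bodies \<psi>"

lemma finite_box_bodies: "finite (box_bodies \<phi>)"
  by (induction \<phi>) auto

text \<open>Witnesses are demanded only for boxes inside \<open>\<theta>\<close>, so finitely many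
  requirements suffice. The map \<open>f\<close> will be either projection of pairs.\<close>

lemma (in s4_logic) selective_truth:
  assumes mcs: "\<And>x. x \<in> W \<Longrightarrow> mcs (f x)"
    and V: "\<And>x p. x \<in> W \<Longrightarrow> p \<in> A \<Longrightarrow> x \<in> V p \<longleftrightarrow> Atom p \<in> f x"
    and R: "\<And>x y. (x, y) \<in> R \<Longrightarrow> (f x, f y) \<in> cR"
    and wit: "\<And>x \<beta>. x \<in> W \<Longrightarrow> \<beta> \<in> B \<Longrightarrow> Box \<beta> \<notin> f x \<Longrightarrow> \<exists>y\<in>W. (x, y) \<in> R \<and> \<beta> \<notin> f y"
  shows "x \<in> W \<Longrightarrow> atoms \<theta> \<subseteq> A \<Longrightarrow> box_bodies \<theta> \<subseteq> B \<Longrightarrow> sat W R V x \<theta> \<longleftrightarrow> \<theta> \<in> f x"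
proof (induction \<theta> arbitrary: x)
  case (Box \<theta>)
  have "\<theta> \<in> f y" if "Box \<theta> \<in> f x" "(x, y) \<in> R" for y
    using R[OF that(2)] that(1) by (auto simp: cR_def unbox_def)
  moreover have "\<exists>y\<in>W. (x, y) \<in> R \<and> \<theta> \<notin> f y" if "Box \<theta> \<notin> f x"
    using wit[OF Box.prems(1) _ that] Box.prems(3) by simp
  ultimately have "Box \<theta> \<in> f x \<longleftrightarrow> (\<forall>y\<in>W. (x, y) \<in> R \<longrightarrow> \<theta> \<in> f y)"
    by blast
  then show ?case
    using Box by simp
qed (use mcs V in auto)

text \<open>The selected frame refutes \<open>Imp \<phi> \<psi>\<close> if there is no interpolant,
  against \<open>sound\<close>. Making confluence conditional on \<open>dot2\<close> treats the
  logics over S4 and S4.2 together.\<close>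

theorem interpolation_bounded_clusters:
  assumes normal: "normal_logic L" "S4 \<subseteq> L"
    and gam: "gam m \<in> L" "gam_bar n \<in> L" and mn: "m \<in> {1, 2, \<infinity>}" "n \<in> {1, 2, \<infinity>}"
    and sound: "\<And>(W :: (form set \<times> form set) set) R \<phi>. preorder_on W R \<Longrightarrow> frame_valid W R (gam m) \<Longrightarrow>
       frame_valid W R (gam_bar n) \<Longrightarrow> (dot2 \<in> L \<Longrightarrow> confluent W R) \<Longrightarrow> \<phi> \<in> L \<Longrightarrow> frame_valid W R \<phi>"
  shows "craig_interpolation L"
  unfolding craig_interpolation_def
proof (intro allI impI, rule ccontr)
  fix \<phi> \<psi>
  assume imp: "Imp \<phi> \<psi> \<in> L"
    and no: "\<not> (\<exists>\<chi>. atoms \<chi> \<subseteq> atoms \<phi> \<inter> atoms \<psi> \<and> Imp \<phi> \<chi> \<in> L \<and> Imp \<chi> \<psi> \<in> L)"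
  interpret amalgam L "atoms \<phi> \<inter> atoms \<psi>"
    using normal by unfold_locales
  \<comment> \<open>A separating formula in the common atoms would be an interpolant.\<close>
  have "\<not> {Neg \<psi>} \<turnstile> Neg \<chi>" if "\<chi> \<in> F" "{\<phi>} \<turnstile> \<chi>" for \<chi>
  proof
    assume "{Neg \<psi>} \<turnstile> Neg \<chi>"
    then have "Imp (Neg \<psi>) (Neg \<chi>) \<in> L"
      by (intro der_empty deduction)
    moreover have "Imp (Imp (Neg \<psi>) (Neg \<chi>)) (Imp \<chi> \<psi>) \<in> L"
      by (rule taut) auto
    ultimately have "Imp \<chi> \<psi> \<in> L"
      using L_mp by blast
    moreover have "Imp \<phi> \<chi> \<in> L"
      using that(2) by (intro der_empty deduction)
    ultimately show False
      using no that(1) by blast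
  qed
  then obtain w0 where w0: "w0 \<in> P" "\<phi> \<in> fst w0" "Neg \<psi> \<in> snd w0"
    using joint_lindenbaum[of "{\<phi>}" "{Neg \<psi>}"] by auto
  obtain W R where W: "W \<subseteq> P" and R: "R = pR \<inter> W \<times> W"
    and w: "\<exists>w\<in>W. \<phi> \<in> fst w \<and> Neg \<psi> \<in> snd w"
    and wit1: "\<And>x \<beta>. x \<in> W \<Longrightarrow> \<beta> \<in> box_bodies \<phi> \<Longrightarrow> Box \<beta> \<notin> fst x \<Longrightarrow> \<exists>y\<in>W. (x, y) \<in> pR \<and> \<beta> \<notin> fst y"
    and wit2: "\<And>x \<beta>. x \<in> W \<Longrightarrow> \<beta> \<in> box_bodies \<psi> \<Longrightarrow> Box \<beta> \<notin> snd x \<Longrightarrow> \<exists>y\<in>W. (x, y) \<in> pR \<and> \<beta> \<notin> snd y"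
    and frame: "preorder_on W R" "frame_valid W R (gam m)" "frame_valid W R (gam_bar n)"
      "dot2 \<in> L \<Longrightarrow> confluent W R"
    using selected_frame[OF gam mn w0 finite_box_bodies[of \<phi>] finite_box_bodies[of \<psi>]] by metis
  \<comment> \<open>On common atoms the components of a pair agree, so giving precedence to the
    first component is also correct for \<open>\<psi>\<close>.\<close>
  define V where "V p = (if p \<in> atoms \<phi> then {x. Atom p \<in> fst x} else {x. Atom p \<in> snd x})" for p
  have "sat W R V x \<phi> \<longleftrightarrow> \<phi> \<in> fst x" if "x \<in> W" for x
  proof (rule selective_truth[where A = "atoms \<phi>" and B = "box_bodies \<phi>"])
    show "\<exists>y\<in>W. (x, y) \<in> R \<and> \<beta> \<notin> fst y" if "x \<in> W" "\<beta> \<in> box_bodies \<phi>" "Box \<beta> \<notin> fst x" for x \<beta>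
      using wit1[OF that] that(1) by (auto simp: R)
  qed (use that W P_mcs pR_fst in \<open>auto simp: V_def R\<close>)
  moreover have "sat W R V x \<psi> \<longleftrightarrow> \<psi> \<in> snd x" if "x \<in> W" for x
  proof (rule selective_truth[where A = "atoms \<psi>" and B = "box_bodies \<psi>"])
    show "\<exists>y\<in>W. (x, y) \<in> R \<and> \<beta> \<notin> snd y" if "x \<in> W" "\<beta> \<in> box_bodies \<psi>" "Box \<beta> \<notin> snd x" for x \<beta>
      using wit2[OF that] that(1) by (auto simp: R)
    show "x \<in> V p \<longleftrightarrow> Atom p \<in> snd x" if "x \<in> W" "p \<in> atoms \<psi>" for x p
      using P_agree[of x "Atom p"] that W by (auto simp: V_def)
  qed (use that W P_mcs pR_snd in \<open>auto simp: R\<close>)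
  moreover have "sat W R V x (Imp \<phi> \<psi>)" if "x \<in> W" for x
    using sound[OF frame imp] that by (simp add: frame_valid_def)
  ultimately show False
    using w W P_mcs(2) by fastforce
qed

text \<open>What remains is soundness: the formulas valid in a frame form a normal logic, so it
  suffices to validate the generators of \<open>Gam\<close>, with \<open>tau\<close> described by
  \<open>tau_IntL\<close> and \<open>tau_KC\<close>.\<close>

theorem theorem5p2:
  fixes \<Lambda> :: "iform set" and m n :: enat
  assumes "\<Lambda> \<in> {IntL, KC}" and "m \<in> {1, 2, \<infinity>}" and "n \<in> {1, 2, \<infinity>}"
  shows "craig_interpolation (Gam \<Lambda> m n)"
proof (rule interpolation_bounded_clusters[OF _ _ _ _ assms(2,3)])
  let ?L = "Gam \<Lambda> m n"
  have ext: "L \<subseteq> L \<oplus> A" "A \<subseteq> L \<oplus> A" for L A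
    by (rule normal_ext_base normal_ext_new)+
  have tau_sub: "tau \<Lambda> \<subseteq> ?L"
    unfolding Gam_def by (rule order_trans[OF ext(1) ext(1)])
  show "normal_logic ?L"
    unfolding Gam_def by (rule normal_ext_normal)
  have "S4 \<subseteq> tau \<Lambda>"
    using assms(1) ext(1)[of S4 "{dot2}"] by (elim insertE) (simp_all add: tau_IntL tau_KC)
  then show "S4 \<subseteq> ?L"
    using tau_sub by (rule order_trans)
  show "gam m \<in> ?L" "gam_bar n \<in> ?L"
    using ext(1)[of "tau \<Lambda> \<oplus> {gam m}" "{gam_bar n}"] ext(2)[of "{gam m}" "tau \<Lambda>"]
      ext(2)[of "{gam_bar n}" "tau \<Lambda> \<oplus> {gam m}"] by (auto simp: Gam_def)
  fix W :: "(form set \<times> form set) set" and R \<phi>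
  assume pre: "preorder_on W R" and val: "frame_valid W R (gam m)" "frame_valid W R (gam_bar n)"
    and conf: "dot2 \<in> ?L \<Longrightarrow> confluent W R" and \<phi>: "\<phi> \<in> ?L"
  let ?v = "{\<phi>. frame_valid W R \<phi>}"
  note norm = normal_logic_frame_valid[of W R]
  have S4: "S4 \<subseteq> ?v"
    using S4_valid[OF _ pre] by blast
  have "tau \<Lambda> \<subseteq> ?v"
  proof (cases "\<Lambda> = IntL")
    case True
    then show ?thesis using S4 by (simp add: tau_IntL)
  next
    case False
    then have tau: "tau \<Lambda> = S4 \<oplus> {dot2}"
      using assms(1) by (simp add: tau_KC)
    \<comment> \<open>Membership of \<open>dot2\<close> makes the confluence assumption
      \<open>conf\<close> available.\<close>
    then have "dot2 \<in> ?L"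
      using tau_sub ext(2)[of "{dot2}" S4] by auto
    then have "frame_valid W R dot2"
      by (rule confluent_dot2[OF conf])
    then show ?thesis
      unfolding tau using S4 by (intro normal_ext_minimal norm) auto
  qed
  then have "?L \<subseteq> ?v"
    unfolding Gam_def using val by (intro normal_ext_minimal norm) auto
  then show "frame_valid W R \<phi>"
    using \<phi> by blast
qed

end
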